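(* There is a parameterized reduction from the decision version of VEST to its special case in which $h=d$ and $S$ is the $d\times d$ identity matrix, and there is a parameterized reduction in the other direction.
   Context: An instance of VEST consists of positive integers $d,m,h$, a vector $\mathbf{v}\in\mathbb{Q}^d$, a list $(T_1,\dots,T_m)$ of rational $d\times d$ matrices, $S\in\mathbb{Q}^{h\times d}$, and a parameter $k$; $M_k := |\{(i_1,\dots,i_k)\in\{1,\dots,m\}^k : S T_{i_k}\cdots T_{i_1}\mathbf{v}=\mathbf{0}\}|$. The decision version asks whether $M_k>0$. A parameterized reduction maps an instance $(x,k)$ in time $f(k)n^c$ to an equivalent instance $(x',k')$ with $k'\le g(k)$, for computable $f,g$ and constant $c$. *)

theory Defs
  imports "Jordan_Normal_Form.Matrix"
begin

section \<open>Multi-tape Turing machines\<close>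

text \<open>
  All strings are over one finite alphabet. Tapes are infinite in both directions, and
  \<^term>\<open>None\<close> is the blank. A machine with \<open>n\<close> states uses the states \<open>0, \<dots>, n - 1\<close>, starts
  in state \<open>0\<close>, and halts on entering state \<open>n\<close>.
\<close>

datatype symbol = Zero | One | Minus | Slash | Comma | Semicolon | Bar

datatype move = MoveLeft | Stay | MoveRight

record tm =
  tape_count :: nat
  state_count :: nat
  transition :: "nat \<Rightarrow> symbol option list \<Rightarrow> nat \<times> (symbol option \<times> move) list"

definition wf_tm :: "tm \<Rightarrow> bool" where
  "wf_tm M \<longleftrightarrow> tape_count M \<ge> 2 \<and>
     (\<forall>q < state_count M. \<forall>ss. length ss = tape_count M \<longrightarrow>
        fst (transition M q ss) \<le> state_count M \<and> length (snd (transition M q ss)) = tape_count M)"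

type_synonym tape = "(int \<Rightarrow> symbol option) \<times> int"

definition read :: "tape \<Rightarrow> symbol option" where
  "read tp = fst tp (snd tp)"

fun offset :: "move \<Rightarrow> int" where
  "offset MoveLeft = - 1"
| "offset Stay = 0"
| "offset MoveRight = 1"

definition act :: "symbol option \<times> move \<Rightarrow> tape \<Rightarrow> tape" where
  "act a tp = ((fst tp)(snd tp := fst a), snd tp + offset (snd a))"

definition step :: "tm \<Rightarrow> nat \<times> tape list \<Rightarrow> nat \<times> tape list" where
  "step M = (\<lambda>(q, tps).
     if q < state_count M
     then (let (q', as) = transition M q (map read tps) in (q', map2 act as tps))
     else (q, tps))"

definition content :: "symbol list \<Rightarrow> int \<Rightarrow> symbol option" where
  "content w i = (if 0 \<le> i \<and> i < int (length w) then Some (w ! nat i) else None)"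

definition initial :: "tm \<Rightarrow> symbol list \<Rightarrow> nat \<times> tape list" where
  "initial M w = (0, (content w, 0) # replicate (tape_count M - 1) (content [], 0))"

text \<open>
  The input is on tape 0 and the output on tape 1. A halted configuration is a fixed point of
  \<^const>\<open>step\<close>, so being halted after exactly \<open>t\<close> iterations means having halted within \<open>t\<close> steps.
\<close>

definition computes_within :: "tm \<Rightarrow> symbol list \<Rightarrow> symbol list \<Rightarrow> nat \<Rightarrow> bool" where
  "computes_within M w u t \<longleftrightarrow>
     (let (q, tps) = (step M ^^ t) (initial M w)
      in q = state_count M \<and> fst (tps ! 1) = content u)"

text \<open>Binary representation, least significant bit first; \<open>0\<close> is the empty string.\<close>

fun bits :: "nat \<Rightarrow> symbol list" where
  "bits n = (if n = 0 then [] else (if even n then Zero else One) # bits (n div 2))"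

declare bits.simps [simp del]

definition computable :: "(nat \<Rightarrow> nat) \<Rightarrow> bool" where
  "computable f \<longleftrightarrow>
     (\<exists>M. wf_tm M \<and> (\<forall>n. \<exists>t. computes_within M (bits n) (bits (f n)) t))"


section \<open>Parameterized problems and reductions\<close>

record 'i param_problem =
  instances :: "'i set"
  yes :: "'i \<Rightarrow> bool"
  parameter :: "'i \<Rightarrow> nat"
  encode :: "'i \<Rightarrow> symbol list"

definition param_reduction ::
    "'i param_problem \<Rightarrow> 'j param_problem \<Rightarrow> ('i \<Rightarrow> 'j) \<Rightarrow> bool" where
  "param_reduction P Q R \<longleftrightarrow>
     (\<forall>x \<in> instances P. R x \<in> instances Q \<and> (yes P x \<longleftrightarrow> yes Q (R x))) \<and>
     (\<exists>g. computable g \<and> (\<forall>x \<in> instances P. parameter Q (R x) \<le> g (parameter P x))) \<and>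
     (\<exists>M f c. wf_tm M \<and> computable f \<and>
        (\<forall>x \<in> instances P.
           computes_within M (encode P x) (encode Q (R x))
             (f (parameter P x) * length (encode P x) ^ c)))"


section \<open>The problem VEST\<close>

text \<open>
  The numbers \<open>d\<close>, \<open>m\<close>, \<open>h\<close> are not stored separately: they are the dimension of the vector,
  the length of the list of matrices, and the number of rows of \<open>S\<close>.
\<close>

record vest =
  start :: "rat vec"
  transforms :: "rat mat list"
  selector :: "rat mat"
  seq_length :: nat

definition valid_vest :: "vest \<Rightarrow> bool" where
  "valid_vest x \<longleftrightarrow>
     (let d = dim_vec (start x); m = length (transforms x); h = dim_row (selector x) in
      d > 0 \<and> m > 0 \<and> h > 0 \<and>
      (\<forall>T \<in> set (transforms x). T \<in> carrier_mat d d) \<and> selector x \<in> carrier_mat h d)"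

text \<open>For a list \<open>[i\<^sub>1, \<dots>, i\<^sub>k]\<close> this is \<open>T\<^bsub>i\<^sub>k\<^esub> \<cdots> T\<^bsub>i\<^sub>1\<^esub> v\<close>: the first index acts first.\<close>

definition apply_transforms :: "rat mat list \<Rightarrow> nat list \<Rightarrow> rat vec \<Rightarrow> rat vec" where
  "apply_transforms Ts is v = fold (\<lambda>i w. (Ts ! i) *\<^sub>v w) is v"

definition vest_count :: "vest \<Rightarrow> nat" where
  "vest_count x =
     card {is. length is = seq_length x \<and> set is \<subseteq> {..<length (transforms x)} \<and>
               selector x *\<^sub>v apply_transforms (transforms x) is (start x)
                 = 0\<^sub>v (dim_row (selector x))}"

definition enc_rat :: "rat \<Rightarrow> symbol list" where
  "enc_rat r = (case quotient_of r of (a, b) \<Rightarrow>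
     (if a < 0 then [Minus] else []) @ bits (nat \<bar>a\<bar>) @ [Slash] @ bits (nat b))"

definition enc_vec :: "rat vec \<Rightarrow> symbol list" where
  "enc_vec v = concat (map (\<lambda>r. enc_rat r @ [Comma]) (list_of_vec v)) @ [Semicolon]"

definition enc_mat :: "rat mat \<Rightarrow> symbol list" where
  "enc_mat A = concat (map enc_vec (rows A)) @ [Bar]"

definition enc_vest :: "vest \<Rightarrow> symbol list" where
  "enc_vest x = bits (seq_length x) @ [Bar] @ enc_vec (start x) @ enc_mat (selector x) @
     concat (map enc_mat (transforms x))"

definition VEST :: "vest param_problem" where
  "VEST = \<lparr>instances = {x. valid_vest x}, yes = (\<lambda>x. vest_count x > 0),
           parameter = seq_length, encode = enc_vest\<rparr>"

definition VEST_identity :: "vest param_problem" where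
  "VEST_identity = VEST\<lparr>instances :=
     {x. valid_vest x \<and> dim_row (selector x) = dim_vec (start x) \<and>
         selector x = 1\<^sub>m (dim_vec (start x))}\<rparr>"

end

theory Submission imports Defs begin

text \<open>
  From VEST to the special case: let \<open>n\<close> be the length of the encoded instance, put two
  coordinates \<open>(c, e)\<close> in front and pad with zeros to total dimension \<open>n\<close>. The new start
  vector has \<open>(c, e) = (k + 1, 1)\<close>. Every new matrix maps \<open>c\<close> to \<open>c - e\<close>; the padded \<open>T\<^sub>i\<close> keep
  \<open>e\<close>, while the padded \<open>S\<close>, a new first matrix of the list, sets \<open>e\<close> to \<open>0\<close>. A word
  of length \<open>k + 1\<close> can only produce the zero vector if it uses \<open>S\<close> (otherwise \<open>e = 1\<close>), and then
  \<open>c\<close> is frozen at \<open>k\<close> minus the number of steps before the first use of \<open>S\<close>; so \<open>S\<close> has to be used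
  exactly once, as the last step. Choosing \<open>n\<close> as the input length lets the machine use a unary copy
  of its input as a ruler for all the padding and for the identity matrix. The parameter bound and
  the factor \<open>f\<close> of the running time can both be \<open>2 k + 1\<close>, whose binary representation is that of
  \<open>k\<close> with \<^const>\<open>One\<close> in front. In the other direction the identity works.
\<close>

section \<open>Tape programs\<close>

text \<open>\<open>Act i f\<close> may look at all heads but changes tape \<open>i\<close> only; the
  tests of \<open>Cond\<close> and \<open>Loop\<close> see all heads as well.\<close>

datatype prog =
    Act nat "symbol option list \<Rightarrow> symbol option \<times> move"
  | Seq prog prog (infixr \<open>;;\<close> 60)
  | Cond "symbol option list \<Rightarrow> bool" prog prog
  | Loop "symbol option list \<Rightarrow> bool" prog

primrec states :: "prog \<Rightarrow> nat" where
  "states (Act i f) = 1"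
| "states (p ;; q) = states p + states q"
| "states (Cond b p q) = Suc (states p + states q)"
| "states (Loop b p) = Suc (states p)"

definition keep :: "symbol option list \<Rightarrow> (symbol option \<times> move) list" where
  "keep ss = map (\<lambda>s. (s, Stay)) ss"

text \<open>A program enters at state \<open>0\<close> and leaves by going to the state \<open>states p\<close>.\<close>

primrec delta :: "prog \<Rightarrow> nat \<Rightarrow> symbol option list \<Rightarrow> nat \<times> (symbol option \<times> move) list" where
  "delta (Act i f) n ss = (1, (keep ss)[i := f ss])"
| "delta (p ;; q) n ss =
     (if n < states p then delta p n ss
      else apfst ((+) (states p)) (delta q (n - states p) ss))"
| "delta (Cond b p q) n ss =
     (case n of
        0 \<Rightarrow> (if b ss then 1 else Suc (states p), keep ss)
      | Suc n \<Rightarrow>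
          (if n < states p
           then apfst (\<lambda>j. if j < states p then Suc j else Suc (states p + states q)) (delta p n ss)
           else apfst (\<lambda>j. Suc (states p + j)) (delta q (n - states p) ss)))"
| "delta (Loop b p) n ss =
     (case n of
        0 \<Rightarrow> (if b ss then 1 else Suc (states p), keep ss)
      | Suc n \<Rightarrow> apfst (\<lambda>j. if j < states p then Suc j else 0) (delta p n ss))"

definition machine :: "nat \<Rightarrow> prog \<Rightarrow> tm" where
  "machine l p = \<lparr>tape_count = l, state_count = states p, transition = delta p\<rparr>"

text \<open>A body without states would start in its own exit state; positivity makes the entry of
  every branch and loop body a genuine state.\<close>

lemma states_pos: "states p > 0"
  by (induction p) auto

lemma delta_bounds:
  "q < states p \<Longrightarrow> fst (delta p q ss) \<le> states p \<and> length (snd (delta p q ss)) = length ss"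
proof (induction p arbitrary: q)
  case (Act i f)
  then show ?case by (simp add: keep_def)
next
  case (Seq p1 p2)
  then show ?case by (cases "q < states p1") (auto simp: trans_le_add1 Seq.IH)
next
  case (Cond b p1 p2)
  then show ?case
    by (cases q) (auto simp: keep_def states_pos Suc_leI)
next
  case (Loop b p)
  then show ?case
    by (cases q) (auto simp: keep_def states_pos Suc_leI)
qed

lemma wf_machine: "l \<ge> 2 \<Longrightarrow> wf_tm (machine l p)"
  by (simp add: wf_tm_def machine_def delta_bounds)

text \<open>\<open>e\<close> also places the exit state \<open>states p\<close>, and nothing is
  required of its image: it may be the entry of the next program, the test of an enclosing loop, or
  the halting state.\<close>

definition embeds :: "prog \<Rightarrow> (nat \<Rightarrow> nat) \<Rightarrow> tm \<Rightarrow> bool" where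
  "embeds p e N \<longleftrightarrow>
     (\<forall>q < states p. e q < state_count N \<and>
        (\<forall>ss. transition N (e q) ss = apfst e (delta p q ss)))"

text \<open>Quantifying over all machines \<open>N\<close> that contain \<open>p\<close> is what makes \<open>runs\<close> compositional.\<close>

definition runs :: "prog \<Rightarrow> tape list \<Rightarrow> tape list \<Rightarrow> nat \<Rightarrow> bool" where
  "runs p s s' T \<longleftrightarrow>
     (\<forall>N e. embeds p e N \<longrightarrow> (\<exists>t\<le>T. (step N ^^ t) (e 0, s) = (e (states p), s')))"

section \<open>Execution rules for the program constructs\<close>

lemma runs_weaken: "runs p s s' T \<Longrightarrow> T \<le> T' \<Longrightarrow> runs p s s' T'"
  unfolding runs_def using order_trans by blast

lemma runs_cong:
  "runs p s s' T \<Longrightarrow> s = t \<Longrightarrow> s' = t' \<Longrightarrow> T \<le> T' \<Longrightarrow> runs p t t' T'"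
  by (auto intro: runs_weaken)

lemma act_keep [simp]: "act (read tp, Stay) tp = tp"
  by (simp add: act_def read_def)

lemma map2_act_keep [simp]: "map2 act (keep (map read s)) s = s"
  by (rule nth_equalityI) (auto simp: keep_def)

lemma embeds_step:
  assumes "embeds p e N" "q < states p"
  shows "step N (e q, s) =
    (e (fst (delta p q (map read s))), map2 act (snd (delta p q (map read s))) s)"
proof (cases "delta p q (map read s)")
  case (Pair q' as)
  then show ?thesis using assms by (simp add: embeds_def step_def)
qed

lemma runs_Act: "runs (Act i f) s (s[i := act (f (map read s)) (s ! i)]) 1"
proof -
  have "map2 act ((keep (map read s))[i := f (map read s)]) s =
      s[i := act (f (map read s)) (s ! i)]"
  proof (rule nth_equalityI)
    fix j assume "j < length (map2 act ((keep (map read s))[i := f (map read s)]) s)"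
    then have "j < length s" by (simp add: keep_def)
    then show "map2 act ((keep (map read s))[i := f (map read s)]) s ! j =
        s[i := act (f (map read s)) (s ! i)] ! j"
      by (cases "i = j") (auto simp: keep_def)
  qed (simp add: keep_def)
  then show ?thesis
    unfolding runs_def by (intro allI impI exI[of _ 1]) (simp add: embeds_step)
qed

lemma runs_Seq:
  assumes p: "runs p s s1 T1" and q: "runs q s1 s2 T2"
  shows "runs (p ;; q) s s2 (T1 + T2)"
  unfolding runs_def
proof (intro allI impI)
  fix N e
  assume e: "embeds (p ;; q) e N"
  have "embeds p e N" using e by (auto simp: embeds_def)
  then obtain t1 where t1: "t1 \<le> T1" "(step N ^^ t1) (e 0, s) = (e (states p), s1)"
    using p unfolding runs_def by blast
  \<comment> \<open>The states of \<open>q\<close> are shifted by \<open>states p\<close>, so the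
    entry of \<open>q\<close> is the exit of \<open>p\<close>.\<close>
  have "embeds q (\<lambda>j. e (states p + j)) N"
    unfolding embeds_def
  proof (intro allI impI conjI)
    fix j ss assume j: "j < states q"
    show "e (states p + j) < state_count N" using e j by (simp add: embeds_def)
    have "transition N (e (states p + j)) ss = apfst e (delta (p ;; q) (states p + j) ss)"
      using e j by (simp add: embeds_def)
    then show "transition N (e (states p + j)) ss = apfst (\<lambda>j. e (states p + j)) (delta q j ss)"
      by (cases "delta q j ss") simp
  qed
  then obtain t2 where t2: "t2 \<le> T2"
      "(step N ^^ t2) (e (states p), s1) = (e (states p + states q), s2)"
    using q unfolding runs_def by fastforce
  have "(step N ^^ (t2 + t1)) (e 0, s) = (e (states (p ;; q)), s2)"
    using t1 t2 by (simp add: funpow_add)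
  then show "\<exists>t\<le>T1 + T2. (step N ^^ t) (e 0, s) = (e (states (p ;; q)), s2)"
    using t1 t2 by (intro exI[of _ "t2 + t1"]) auto
qed

lemma runs_Cond_True:
  assumes b: "b (map read s)" and p: "runs p s s' T"
  shows "runs (Cond b p q) s s' (Suc T)"
  unfolding runs_def
proof (intro allI impI)
  fix N e
  assume e: "embeds (Cond b p q) e N"
  \<comment> \<open>The exit of \<open>p\<close> is redirected past the states of \<open>q\<close>,
    to the exit of the conditional.\<close>
  define e1 where "e1 j = (if j < states p then e (Suc j) else e (Suc (states p + states q)))" for j
  have "embeds p e1 N"
    unfolding embeds_def
  proof (intro allI impI conjI)
    fix j ss assume j: "j < states p"
    then have sj: "Suc j < states (Cond b p q)" by simp
    show "e1 j < state_count N" using e j sj unfolding embeds_def e1_def by auto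
    have "transition N (e (Suc j)) ss = apfst e (delta (Cond b p q) (Suc j) ss)"
      using e sj unfolding embeds_def by blast
    then show "transition N (e1 j) ss = apfst e1 (delta p j ss)"
      using j by (cases "delta p j ss") (simp add: e1_def)
  qed
  then obtain t where t: "t \<le> T" "(step N ^^ t) (e1 0, s) = (e1 (states p), s')"
    using p unfolding runs_def by blast
  have "(step N ^^ Suc t) (e 0, s) = (e (states (Cond b p q)), s')"
    using t b by (simp add: funpow_Suc_right embeds_step[OF e] e1_def states_pos del: funpow.simps)
  then show "\<exists>t\<le>Suc T. (step N ^^ t) (e 0, s) = (e (states (Cond b p q)), s')"
    using t by blast
qed

lemma runs_Cond_False:
  assumes b: "\<not> b (map read s)" and q: "runs q s s' T"
  shows "runs (Cond b p q) s s' (Suc T)"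
  unfolding runs_def
proof (intro allI impI)
  fix N e
  assume e: "embeds (Cond b p q) e N"
  \<comment> \<open>No redirection here: the shifted exit of \<open>q\<close> is already the exit of
    the conditional.\<close>
  have "embeds q (\<lambda>j. e (Suc (states p + j))) N"
    unfolding embeds_def
  proof (intro allI impI conjI)
    fix j ss assume j: "j < states q"
    then have sj: "Suc (states p + j) < states (Cond b p q)" by simp
    show "e (Suc (states p + j)) < state_count N" using e sj unfolding embeds_def by blast
    have "transition N (e (Suc (states p + j))) ss =
        apfst e (delta (Cond b p q) (Suc (states p + j)) ss)"
      using e sj unfolding embeds_def by blast
    then show "transition N (e (Suc (states p + j))) ss =
        apfst (\<lambda>j. e (Suc (states p + j))) (delta q j ss)"
      by (cases "delta q j ss") simp
  qed
  then obtain t where t: "t \<le> T"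
      "(step N ^^ t) (e (Suc (states p)), s) = (e (Suc (states p + states q)), s')"
    using q unfolding runs_def by fastforce
  have "(step N ^^ Suc t) (e 0, s) = (e (states (Cond b p q)), s')"
    using t b by (simp add: funpow_Suc_right embeds_step[OF e] del: funpow.simps)
  then show "\<exists>t\<le>Suc T. (step N ^^ t) (e 0, s) = (e (states (Cond b p q)), s')"
    using t by blast
qed

lemma runs_Loop_False:
  assumes "\<not> b (map read s)"
  shows "runs (Loop b p) s s 1"
  unfolding runs_def
  by (intro allI impI exI[of _ 1]) (simp add: embeds_step assms)

text \<open>One unrolling. Every loop below is treated by induction, with this rule for the step and
  \<open>runs_Loop_False\<close> for the base.\<close>

lemma runs_Loop_True:
  assumes b: "b (map read s)" and p: "runs p s s1 T1" and l: "runs (Loop b p) s1 s2 T2"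
  shows "runs (Loop b p) s s2 (Suc (T1 + T2))"
  unfolding runs_def
proof (intro allI impI)
  fix N e
  assume e: "embeds (Loop b p) e N"
  \<comment> \<open>The exit of the body leads back to the test in state 0.\<close>
  define e1 where "e1 j = (if j < states p then e (Suc j) else e 0)" for j
  have "embeds p e1 N"
    unfolding embeds_def
  proof (intro allI impI conjI)
    fix j ss assume j: "j < states p"
    then have sj: "Suc j < states (Loop b p)" by simp
    show "e1 j < state_count N" using e j sj unfolding embeds_def e1_def by auto
    have "transition N (e (Suc j)) ss = apfst e (delta (Loop b p) (Suc j) ss)"
      using e sj unfolding embeds_def by blast
    then show "transition N (e1 j) ss = apfst e1 (delta p j ss)"
      using j by (cases "delta p j ss") (simp add: e1_def)
  qed
  then obtain t1 where t1: "t1 \<le> T1" "(step N ^^ t1) (e1 0, s) = (e1 (states p), s1)"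
    using p unfolding runs_def by blast
  obtain t2 where t2: "t2 \<le> T2" "(step N ^^ t2) (e 0, s1) = (e (states (Loop b p)), s2)"
    using l e unfolding runs_def by blast
  have "(step N ^^ (Suc t1)) (e 0, s) = (e 0, s1)"
    using t1 b by (simp add: funpow_Suc_right embeds_step[OF e] e1_def states_pos del: funpow.simps)
  then have "(step N ^^ (t2 + Suc t1)) (e 0, s) = (e (states (Loop b p)), s2)"
    using t2 by (simp only: funpow_add o_apply)
  then show "\<exists>t\<le>Suc (T1 + T2). (step N ^^ t) (e 0, s) = (e (states (Loop b p)), s2)"
    using t1 t2 by (intro exI[of _ "t2 + Suc t1"]) auto
qed

lemma step_halted: "(step M ^^ t) (state_count M, s) = (state_count M, s)"
  by (induction t) (auto simp: step_def)

lemma runs_computes_within: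
  assumes r: "runs p ((content w, 0) # replicate (l - 1) (content [], 0)) s' T"
    and u: "fst (s' ! 1) = content u"
  shows "computes_within (machine l p) w u T"
proof -
  have "embeds p (\<lambda>q. q) (machine l p)"
    by (simp add: embeds_def machine_def apfst_def map_prod_def)
  then obtain t where t: "t \<le> T" "(step (machine l p) ^^ t) (initial (machine l p) w) = (states p, s')"
    using r unfolding runs_def initial_def by (fastforce simp: machine_def)
  \<comment> \<open>\<open>T\<close> is only an upper bound; the remaining \<open>T - t\<close>
    steps are spent in the halted configuration.\<close>
  have "(step (machine l p) ^^ (T - t + t)) (initial (machine l p) w) = (states p, s')"
    using t step_halted[where M = "machine l p" and t = "T - t" and s = s']
    by (simp only: funpow_add o_apply) (simp add: machine_def)
  then show ?thesis using t u by (simp add: computes_within_def machine_def)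
qed

text \<open>A tape as a zipper: \<open>u\<close> lies to the left of the head, and an empty
  \<open>v\<close> means that the head is on the first blank after the content, as on an output
  tape.\<close>

definition zip_tape :: "symbol list \<Rightarrow> symbol list \<Rightarrow> tape" where
  "zip_tape u v = (content (u @ v), int (length u))"

lemma read_zip_tape [simp]:
  "read (zip_tape u []) = None" "read (zip_tape u (x # v)) = Some x"
  by (auto simp: read_def zip_tape_def content_def)

lemma content_update: "(content (u @ x # v))(int (length u) := Some y) = content (u @ y # v)"
  by (rule ext) (auto simp: content_def nth_append nth_Cons')

lemma content_append_update: "(content u)(int (length u) := Some y) = content (u @ [y])"
  by (rule ext) (auto simp: content_def nth_append)

lemma act_zip_tape_right [simp]:
  "act (Some y, MoveRight) (zip_tape u (x # v)) = zip_tape (u @ [y]) v"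
  "act (Some y, MoveRight) (zip_tape u []) = zip_tape (u @ [y]) []"
  "act (Some y, Stay) (zip_tape u (x # v)) = zip_tape u (y # v)"
  by (simp_all add: act_def zip_tape_def content_update content_append_update)

section \<open>Elementary programs: moving, writing, copying, rewinding\<close>

definition skip :: prog where
  "skip = Act 0 (\<lambda>ss. (ss ! 0, Stay))"

definition right :: "nat \<Rightarrow> prog" where
  "right i = Act i (\<lambda>ss. (ss ! i, MoveRight))"

definition left :: "nat \<Rightarrow> prog" where
  "left i = Act i (\<lambda>ss. (ss ! i, MoveLeft))"

definition emit :: "nat \<Rightarrow> symbol \<Rightarrow> prog" where
  "emit i x = Act i (\<lambda>_. (Some x, MoveRight))"

definition emits :: "symbol list \<Rightarrow> prog" where
  "emits xs = foldr (\<lambda>x p. emit 1 x ;; p) xs skip"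

definition copy :: prog where
  "copy = Act 1 (\<lambda>ss. (ss ! 0, MoveRight)) ;; right 0"

text \<open>The first move is unconditional because the head may be on the blank behind the content,
  where the loop would stop at once. The loop ends on the blank before the content, hence the final
  move to the right.\<close>

definition rewind :: "nat \<Rightarrow> prog" where
  "rewind i = left i ;; Loop (\<lambda>ss. ss ! i \<noteq> None) (left i) ;; right i"

lemma runs_Act':
  "s' = s[i := act (f (map read s)) (s ! i)] \<Longrightarrow> runs (Act i f) s s' 1"
  using runs_Act by simp

lemma runs_skip: "s \<noteq> [] \<Longrightarrow> runs skip s s 1"
  unfolding skip_def by (rule runs_Act') (cases s; simp)

lemma runs_right:
  "runs (right 0) (zip_tape u (x # v) # r) (zip_tape (u @ [x]) v # r) 1"
  "runs (right 2) (a # b # zip_tape u (x # v) # r) (a # b # zip_tape (u @ [x]) v # r) 1"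
  "runs (right 3) (a # b # c # zip_tape u (x # v) # r) (a # b # c # zip_tape (u @ [x]) v # r) 1"
  unfolding right_def by (rule runs_Act'; simp add: numeral_eq_Suc)+

lemma runs_emit:
  "runs (emit 1 x) (a # zip_tape w [] # r) (a # zip_tape (w @ [x]) [] # r) 1"
  "runs (emit 2 x) (a # b # zip_tape w [] # r) (a # b # zip_tape (w @ [x]) [] # r) 1"
  "runs (emit 3 x) (a # b # c # zip_tape w [] # r) (a # b # c # zip_tape (w @ [x]) [] # r) 1"
  unfolding emit_def by (rule runs_Act'; simp add: numeral_eq_Suc)+

lemma runs_emits:
  "runs (emits xs) (a # zip_tape w [] # r) (a # zip_tape (w @ xs) [] # r) (length xs + 1)"
proof (induction xs arbitrary: w)
  case Nil
  show ?case by (simp add: emits_def runs_skip[THEN runs_weaken])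
next
  case (Cons x xs)
  have "runs (emits (x # xs)) (a # zip_tape w [] # r)
      (a # zip_tape ((w @ [x]) @ xs) [] # r) (1 + (length xs + 1))"
    using runs_Seq[OF runs_emit(1) Cons.IH] by (simp add: emits_def)
  then show ?case by simp
qed

lemma runs_copy:
  "runs copy (zip_tape u (x # v) # zip_tape w [] # r)
     (zip_tape (u @ [x]) v # zip_tape (w @ [x]) [] # r) 2"
proof -
  have "runs (Act 1 (\<lambda>ss. (ss ! 0, MoveRight))) (zip_tape u (x # v) # zip_tape w [] # r)
      (zip_tape u (x # v) # zip_tape (w @ [x]) [] # r) 1"
    by (rule runs_Act') simp
  from runs_Seq[OF this runs_right(1)] show ?thesis
    by (simp add: copy_def numeral_2_eq_2)
qed

lemma runs_rewind:
  assumes i: "i < length s" and si: "s ! i = zip_tape u v"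
  shows "runs (rewind i) s (s[i := zip_tape [] (u @ v)]) (2 * length u + 5)"
proof -
  \<comment> \<open>Absolute head positions, since the stop at position -1 is not a
    \<open>zip_tape\<close>.\<close>
  define tp where "tp j = (content (u @ v), j)" for j :: int
  have cont: "(content w)(j := content w j) = content w" for w j by simp
  have left: "runs (left i) (s[i := tp j]) (s[i := tp (j - 1)]) 1" for j
    unfolding left_def using i by (intro runs_Act') (simp add: act_def tp_def read_def)
  have loop: "runs (Loop (\<lambda>ss. ss ! i \<noteq> None) (left i)) (s[i := tp (int j - 1)])
      (s[i := tp (- 1)]) (2 * j + 1)" if "j \<le> length u" for j
    using that
  proof (induction j)
    case 0
    have "runs (Loop (\<lambda>ss. ss ! i \<noteq> None) (left i)) (s[i := tp (- 1)]) (s[i := tp (- 1)]) 1"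
      using i by (intro runs_Loop_False) (simp add: tp_def read_def content_def)
    then show ?case by simp
  next
    case (Suc j)
    have "runs (Loop (\<lambda>ss. ss ! i \<noteq> None) (left i)) (s[i := tp (int j)])
        (s[i := tp (- 1)]) (Suc (1 + (2 * j + 1)))"
      by (rule runs_Loop_True[OF _ left])
        (use i Suc in \<open>simp_all add: tp_def read_def content_def\<close>)
    then show ?case by simp
  qed
  have "runs (right i) (s[i := tp (- 1)]) (s[i := tp 0]) 1"
    unfolding right_def using i by (intro runs_Act') (simp add: act_def tp_def read_def)
  from runs_Seq[OF left[of "int (length u)"] runs_Seq[OF loop[OF order_refl] this]]
  have "runs (rewind i) (s[i := tp (int (length u))]) (s[i := tp 0]) (2 * length u + 5)"
    unfolding rewind_def by (rule runs_weaken) simp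
  moreover have "s[i := tp (int (length u))] = s"
    using si by (metis list_update_id tp_def zip_tape_def)
  ultimately show ?thesis by (simp add: tp_def zip_tape_def)
qed

definition copy_until :: "symbol option \<Rightarrow> prog" where
  "copy_until z = Loop (\<lambda>ss. ss ! 0 \<noteq> z) copy"

text \<open>By the second hypothesis \<open>z\<close> is what the head reads behind
  \<open>xs\<close>, so one program covers copying to the end of the tape and copying a field up to
  its separator.\<close>

lemma runs_copy_until:
  assumes "z \<notin> Some ` set xs" "z = (case v of [] \<Rightarrow> None | y # _ \<Rightarrow> Some y)"
  shows "runs (copy_until z) (zip_tape u (xs @ v) # zip_tape w [] # r)
     (zip_tape (u @ xs) v # zip_tape (w @ xs) [] # r) (3 * length xs + 1)"
  using assms(1)
proof (induction xs arbitrary: u w)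
  case Nil
  have "runs (copy_until z) (zip_tape u v # zip_tape w [] # r) (zip_tape u v # zip_tape w [] # r) 1"
    unfolding copy_until_def using assms(2) by (intro runs_Loop_False) (auto split: list.splits)
  then show ?case by simp
next
  case (Cons x xs)
  have "runs (copy_until z) (zip_tape u (x # xs @ v) # zip_tape w [] # r)
     (zip_tape ((u @ [x]) @ xs) v # zip_tape ((w @ [x]) @ xs) [] # r) (Suc (2 + (3 * length xs + 1)))"
    unfolding copy_until_def
    by (rule runs_Loop_True[OF _ runs_copy Cons.IH[unfolded copy_until_def]]) (use Cons.prems in auto)
  then show ?case by (auto elim: runs_weaken)
qed

section \<open>Binary numbers and a computable bound\<close>

lemma bits_0 [simp]: "bits 0 = []"
  by (simp add: bits.simps)

lemma bits_pos: "n > 0 \<Longrightarrow> bits n = (if even n then Zero else One) # bits (n div 2)"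
  by (subst bits.simps) simp

lemma bits_1 [simp]: "bits (Suc 0) = [One]"
  by (simp add: bits_pos)

lemma set_bits: "set (bits n) \<subseteq> {Zero, One}"
proof (induction n rule: less_induct)
  case (less n)
  show ?case
  proof (cases "n = 0")
    case False
    then have "set (bits (n div 2)) \<subseteq> {Zero, One}" by (intro less) simp
    then show ?thesis using False by (simp add: bits_pos)
  qed simp
qed

lemma bits_odd: "bits (2 * n + 1) = One # bits n"
  by (simp add: bits_pos)

text \<open>This function dominates the new parameter \<open>k + 1\<close> and is at least 1, as a
  factor that only weakens a time bound should be.\<close>

lemma computable_odd: "computable (\<lambda>n. 2 * n + 1)"
  unfolding computable_def
proof (intro exI[of _ "machine 2 (emits [One] ;; copy_until None)"] conjI allI)
  show "wf_tm (machine 2 (emits [One] ;; copy_until None))" by (simp add: wf_machine)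
  fix n
  have "runs (emits [One] ;; copy_until None) (zip_tape [] (bits n @ []) # zip_tape [] [] # [])
    (zip_tape ([] @ bits n) [] # zip_tape (([] @ [One]) @ bits n) [] # []) (2 + (3 * length (bits n) + 1))"
    by (rule runs_Seq[OF runs_emits[THEN runs_weaken] runs_copy_until]) simp_all
  then have "computes_within (machine 2 (emits [One] ;; copy_until None)) (bits n) (bits (2 * n + 1))
      (2 + (3 * length (bits n) + 1))"
    by (intro runs_computes_within) (auto simp: zip_tape_def bits_odd[simplified])
  then show "\<exists>t. computes_within (machine 2 (emits [One] ;; copy_until None)) (bits n) (bits (2 * n + 1)) t"
    by blast
qed

section \<open>The machine of the reduction\<close>

text \<open>Rows as plain lists: the analysis of the machine is about lists only, and vectors and
  matrices enter later through \<open>enc_vec_row_text\<close> and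
  \<open>enc_mat_matrix_text\<close>.\<close>

definition entries :: "rat list \<Rightarrow> symbol list" where
  "entries xs = concat (map (\<lambda>r. enc_rat r @ [Comma]) xs)"

definition row_text :: "rat list \<Rightarrow> symbol list" where
  "row_text xs = entries xs @ [Semicolon]"

definition matrix_text :: "rat list list \<Rightarrow> symbol list" where
  "matrix_text rs = concat (map row_text rs) @ [Bar]"

lemma enc_rat_of_nat: "enc_rat (of_nat k) = bits k @ [Slash, One]"
  using quotient_of_int[of "int k"] by (simp add: enc_rat_def)

lemma enc_rat_simps [simp]:
  "enc_rat 0 = [Slash, One]" "enc_rat 1 = [One, Slash, One]" "enc_rat (- 1) = [Minus, One, Slash, One]"
  by (simp_all add: enc_rat_def)

text \<open>Keeps \<open>Comma\<close>, \<open>Semicolon\<close> and \<open>Bar\<close> out of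
  numbers, so the machine can parse by looking for these separators alone.\<close>

lemma set_enc_rat: "set (enc_rat r) \<subseteq> {Zero, One, Minus, Slash}"
  using set_bits by (auto simp: enc_rat_def split: prod.splits; blast)

lemma entries_simps [simp]:
  "entries [] = []" "entries (x # xs) = enc_rat x @ Comma # entries xs"
  "entries (xs @ ys) = entries xs @ entries ys"
  by (simp_all add: entries_def)

lemma row_text_append:
  "row_text (x # xs) = enc_rat x @ Comma # row_text xs"
  "row_text (xs @ ys) = entries xs @ row_text ys"
  by (simp_all add: row_text_def)

lemma Semicolon_notin_entries: "Semicolon \<notin> set (entries xs)"
  by (induction xs) (use set_enc_rat in auto)

text \<open>Justifies measuring a row by counting commas, which is how \<open>copy_row\<close> finds
  the amount of padding.\<close>

lemma count_Comma_entries: "count_list (entries xs) Comma = length xs"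
proof (induction xs)
  case (Cons x xs)
  have "Comma \<notin> set (enc_rat x)" using set_enc_rat by blast
  then show ?case using Cons by (simp add: count_list_0_iff)
qed simp

lemma length_entries_ge: "length xs \<le> length (entries xs)"
  by (induction xs) auto

lemma length_matrix_text:
  "length rs \<le> length (matrix_text rs)"
  "r \<in> set rs \<Longrightarrow> length (entries r) \<le> length (matrix_text rs)"
proof -
  show "length rs \<le> length (matrix_text rs)"
    by (induction rs) (auto simp: matrix_text_def row_text_def)
  show "r \<in> set rs \<Longrightarrow> length (entries r) \<le> length (matrix_text rs)"
    by (induction rs) (auto simp: matrix_text_def row_text_def)
qed

section \<open>Writing and padding a single row\<close>

abbreviation zeros :: "nat \<Rightarrow> symbol list" where
  "zeros n \<equiv> replicate n Zero"

text \<open>Tape 2 is a template for a row: \<open>One\<close> stands for the entry 1, any other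
  symbol for 0.\<close>

definition digit :: "symbol \<Rightarrow> rat" where
  "digit x = (if x = One then 1 else 0)"

text \<open>The head position on tape 2 is the number of entries of the row written so far; the
  cells from the head on supply the missing ones.\<close>

definition fill_row :: prog where
  "fill_row =
     Loop (\<lambda>ss. ss ! 2 \<noteq> None)
       (Cond (\<lambda>ss. ss ! 2 = Some One) (emit 1 One) skip ;; emits [Slash, One, Comma] ;; right 2) ;;
     emit 1 Semicolon ;; rewind 2"

lemma runs_rewind2:
  "runs (rewind 2) (a # b # zip_tape u v # r) (a # b # zip_tape [] (u @ v) # r) (2 * length u + 5)"
  using runs_rewind[of 2 "a # b # zip_tape u v # r" u v] by (simp add: numeral_eq_Suc)

lemma runs_rewind3:
  "runs (rewind 3) (a # b # c # zip_tape u v # r) (a # b # c # zip_tape [] (u @ v) # r) (2 * length u + 5)"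
  using runs_rewind[of 3 "a # b # c # zip_tape u v # r" u v] by (simp add: numeral_eq_Suc)

lemma runs_rewind0:
  "runs (rewind 0) (zip_tape u v # r) (zip_tape [] (u @ v) # r) (2 * length u + 5)"
  using runs_rewind[of 0 "zip_tape u v # r" u v] by simp

lemma runs_fill_row:
  "runs fill_row (a # zip_tape w [] # zip_tape u v # r)
     (a # zip_tape (w @ row_text (map digit v)) [] # zip_tape [] (u @ v) # r)
     (10 * (length u + length v) + 7)"
proof -
  let ?b = "Cond (\<lambda>ss. ss ! 2 = Some One) (emit 1 One) skip ;; emits [Slash, One, Comma] ;; right 2"
  have body: "runs ?b (a # zip_tape w [] # zip_tape u (x # v) # r)
      (a # zip_tape (w @ entries [digit x]) [] # zip_tape (u @ [x]) v # r) 7" for w u x v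
  proof -
    \<comment> \<open>The numerator: 1 is written as \<open>One\<close>, while 0 is the empty
      string.\<close>
    have "runs (Cond (\<lambda>ss. ss ! 2 = Some One) (emit 1 One) skip) (a # zip_tape w [] # zip_tape u (x # v) # r)
        (a # zip_tape (w @ (if x = One then [One] else [])) [] # zip_tape u (x # v) # r) (Suc 1)"
    proof (cases "x = One")
      case True
      then show ?thesis using runs_Cond_True[OF _ runs_emit(1)] by simp
    next
      case False
      then show ?thesis using runs_Cond_False[OF _ runs_skip] by simp
    qed
    from runs_Seq[OF this runs_Seq[OF runs_emits runs_right(2)]]
    show ?thesis by (rule runs_cong) (auto simp: digit_def)
  qed
  have loop: "runs (Loop (\<lambda>ss. ss ! 2 \<noteq> None) ?b) (a # zip_tape w [] # zip_tape u v # r)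
      (a # zip_tape (w @ entries (map digit v)) [] # zip_tape (u @ v) [] # r) (8 * length v + 1)" for w u
  proof (induction v arbitrary: w u)
    case Nil
    show ?case by (simp add: runs_Loop_False[THEN runs_weaken])
  next
    case (Cons x v)
    have "runs (Loop (\<lambda>ss. ss ! 2 \<noteq> None) ?b) (a # zip_tape w [] # zip_tape u (x # v) # r)
      (a # zip_tape ((w @ entries [digit x]) @ entries (map digit v)) [] # zip_tape ((u @ [x]) @ v) [] # r)
      (Suc (7 + (8 * length v + 1)))"
      by (rule runs_Loop_True[OF _ body Cons.IH]) simp
    then show ?case by (auto elim: runs_weaken)
  qed
  from runs_Seq[OF loop runs_Seq[OF runs_emit(1) runs_rewind2]]
  show ?thesis unfolding fill_row_def
    by (rule runs_cong) (auto simp: row_text_def)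
qed

definition copy_row :: prog where
  "copy_row =
     Loop (\<lambda>ss. ss ! 0 \<noteq> Some Semicolon) (Cond (\<lambda>ss. ss ! 0 = Some Comma) (right 2) skip ;; copy) ;;
     right 0 ;; fill_row"

text \<open>Tape 2 advances at every comma, so when the entries of \<open>xs\<close> are exhausted
  exactly \<open>b\<close> of its cells remain, and these become the zero padding. The offset
  \<open>a\<close> accounts for entries written earlier.\<close>

lemma runs_copy_row:
  "runs copy_row
     (zip_tape u (row_text xs @ v) # zip_tape w [] # zip_tape (zeros a) (zeros (length xs + b)) # r)
     (zip_tape (u @ row_text xs) v # zip_tape (w @ row_text (xs @ replicate b 0)) [] #
      zip_tape [] (zeros (a + length xs + b)) # r)
     (5 * length (entries xs) + 10 * (a + length xs + b) + 9)"
proof -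
  let ?b = "Cond (\<lambda>ss. ss ! 0 = Some Comma) (right 2) skip ;; copy"
  \<comment> \<open>The induction is over single symbols, hence over an arbitrary string
    \<open>s\<close> without \<open>Semicolon\<close> in place of the text of a row.\<close>
  have loop: "runs (Loop (\<lambda>ss. ss ! 0 \<noteq> Some Semicolon) ?b)
     (zip_tape u (s @ Semicolon # v) # zip_tape w [] # zip_tape (zeros a) (zeros (count_list s Comma + b)) # r)
     (zip_tape (u @ s) (Semicolon # v) # zip_tape (w @ s) [] #
      zip_tape (zeros (a + count_list s Comma)) (zeros b) # r)
     (5 * length s + 1)" if "Semicolon \<notin> set s" for s u w a
    using that
  proof (induction s arbitrary: u w a)
    case Nil
    show ?case by (simp add: runs_Loop_False[THEN runs_weaken])
  next
    case (Cons x s)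
    let ?a = "if x = Comma then Suc a else a"
    have "runs (Cond (\<lambda>ss. ss ! 0 = Some Comma) (right 2) skip)
       (zip_tape u (x # s @ Semicolon # v) # zip_tape w [] #
         zip_tape (zeros a) (zeros (count_list (x # s) Comma + b)) # r)
       (zip_tape u (x # s @ Semicolon # v) # zip_tape w [] #
         zip_tape (zeros ?a) (zeros (count_list s Comma + b)) # r) (Suc 1)"
    proof (cases "x = Comma")
      case True
      show ?thesis
        by (rule runs_Cond_True[OF _ runs_right(2)[THEN runs_cong]])
          (use True in \<open>auto simp: replicate_append_same\<close>)
    next
      case False
      then show ?thesis using runs_Cond_False[OF _ runs_skip] by simp
    qed
    note body = runs_Seq[OF this[unfolded append_Cons] runs_copy]
    have "runs (Loop (\<lambda>ss. ss ! 0 \<noteq> Some Semicolon) ?b)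
     (zip_tape u (x # s @ Semicolon # v) # zip_tape w [] #
      zip_tape (zeros a) (zeros (count_list (x # s) Comma + b)) # r)
     (zip_tape ((u @ [x]) @ s) (Semicolon # v) # zip_tape ((w @ [x]) @ s) [] #
      zip_tape (zeros (?a + count_list s Comma)) (zeros b) # r)
      (Suc (Suc 1 + 2 + (5 * length s + 1)))"
      by (rule runs_Loop_True[OF _ body Cons.IH, unfolded append_Cons]) (use Cons.prems in auto)
    then show ?case by (rule runs_cong) auto
  qed
  have "runs (Loop (\<lambda>ss. ss ! 0 \<noteq> Some Semicolon) ?b)
     (zip_tape u (row_text xs @ v) # zip_tape w [] # zip_tape (zeros a) (zeros (length xs + b)) # r)
     (zip_tape (u @ entries xs) (Semicolon # v) # zip_tape (w @ entries xs) [] #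
      zip_tape (zeros (a + length xs)) (zeros b) # r)
     (5 * length (entries xs) + 1)"
    using loop[OF Semicolon_notin_entries, of u xs w a] by (simp add: row_text_def count_Comma_entries)
  from runs_Seq[OF this runs_Seq[OF runs_right(1) runs_fill_row]]
  show ?thesis unfolding copy_row_def
    by (rule runs_cong)
      (auto simp: row_text_def digit_def replicate_add)
qed

section \<open>Padding a whole matrix\<close>

definition head :: "rat \<Rightarrow> rat \<Rightarrow> prog" where
  "head x y = emits (entries [x, y]) ;; right 2 ;; right 2"

lemma runs_head:
  "runs (head x y) (a # zip_tape w [] # zip_tape [] (zeros (Suc (Suc n))) # r)
     (a # zip_tape (w @ entries [x, y]) [] # zip_tape (zeros 2) (zeros n) # r)
     (length (entries [x, y]) + 3)"
proof -
  have "runs (head x y) (a # zip_tape w [] # zip_tape [] (Zero # Zero # zeros n) # r)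
     (a # zip_tape (w @ entries [x, y]) [] # zip_tape (([] @ [Zero]) @ [Zero]) (zeros n) # r)
     ((length (entries [x, y]) + 1) + (1 + 1))"
    unfolding head_def by (rule runs_Seq[OF runs_emits runs_Seq[OF runs_right(2) runs_right(2)]])
  then show ?thesis by (simp add: numeral_eq_Suc)
qed

text \<open>Block diagonal form: the block with rows \<open>1, -1\<close> and \<open>0, e\<close>
  acts on the two front coordinates, the given matrix on the next ones, and zero rows make the
  result square. The value of \<open>e\<close> is 1 for a transform and 0 for the selector.\<close>

definition pad_rows :: "nat \<Rightarrow> rat \<Rightarrow> rat list list \<Rightarrow> rat list list" where
  "pad_rows n e rs =
     ([1, - 1] @ replicate (n - 2) 0) # ([0, e] @ replicate (n - 2) 0) #
     map (\<lambda>r. [0, 0] @ r @ replicate (n - 2 - length r) 0) rs @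
     replicate (n - 2 - length rs) (replicate n 0)"

definition top_row :: "rat \<Rightarrow> rat \<Rightarrow> prog" where
  "top_row x y = head x y ;; fill_row"

lemma runs_top_row:
  assumes "n \<ge> 2"
  shows "runs (top_row x y) (a # zip_tape w [] # zip_tape [] (zeros n) # r)
     (a # zip_tape (w @ row_text ([x, y] @ replicate (n - 2) 0)) [] # zip_tape [] (zeros n) # r)
     (length (entries [x, y]) + 10 * n + 10)"
proof -
  obtain m where n: "n = Suc (Suc m)" using assms by (metis add_2_eq_Suc le_Suc_ex)
  show ?thesis
    unfolding top_row_def n
    by (rule runs_Seq[OF runs_head runs_fill_row, THEN runs_cong])
      (auto simp: digit_def row_text_append numeral_eq_Suc)
qed

text \<open>Tape 3 is to rows what tape 2 is to entries: two moves for the top rows, one for each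
  copied row, and the cells left over become zero rows.\<close>

definition copy_matrix :: "rat \<Rightarrow> prog" where
  "copy_matrix e =
     top_row 1 (- 1) ;; top_row 0 e ;; right 3 ;; right 3 ;;
     Loop (\<lambda>ss. ss ! 0 \<noteq> Some Bar) (head 0 0 ;; copy_row ;; right 3) ;; right 0 ;;
     Loop (\<lambda>ss. ss ! 3 \<noteq> None) (fill_row ;; right 3) ;;
     emit 1 Bar ;; rewind 3"

text \<open>Ensures that the copying loop, which stops at \<open>Bar\<close>, enters its body as
  long as a row is left: even an empty row starts with \<open>Semicolon\<close>.\<close>

lemma row_text_not_Bar:
  obtains x xs' where "row_text xs @ v = x # xs'" "x \<noteq> Bar"
proof (cases xs)
  case Nil
  then show ?thesis using that by (simp add: row_text_def)
next
  case (Cons y ys)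
  have "set (enc_rat y) \<subseteq> {Zero, One, Minus, Slash}" by (rule set_enc_rat)
  then show ?thesis using that Cons by (cases "enc_rat y") (auto simp: row_text_def)
qed

text \<open>Here \<open>n\<close> is the dimension without the two front coordinates, and
  \<open>L\<close> is a uniform bound that lets every row be charged the same time.\<close>

lemma runs_copy_rows:
  assumes "\<And>x. x \<in> set rs \<Longrightarrow> length x \<le> n \<and> length (entries x) \<le> L"
  shows "runs (Loop (\<lambda>ss. ss ! 0 \<noteq> Some Bar) (head 0 0 ;; copy_row ;; right 3))
     [zip_tape u (matrix_text rs @ v), zip_tape w [], zip_tape [] (zeros (Suc (Suc n))),
      zip_tape (zeros a) (zeros (length rs + b))]
     [zip_tape (u @ concat (map row_text rs)) (Bar # v),
      zip_tape (w @ concat (map (\<lambda>r. row_text ([0, 0] @ r @ replicate (n - length r) 0)) rs)) [],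
      zip_tape [] (zeros (Suc (Suc n))), zip_tape (zeros (a + length rs)) (zeros b)]
     (length rs * (5 * L + 10 * n + 50) + 1)"
  using assms
proof (induction rs arbitrary: u w a)
  case Nil
  show ?case by (simp add: matrix_text_def runs_Loop_False[THEN runs_weaken])
next
  case (Cons x rs)
  have x: "length x \<le> n" "length (entries x) \<le> L" using Cons.prems by auto
  have "runs (head 0 0 ;; copy_row ;; right 3)
      [zip_tape u (row_text x @ matrix_text rs @ v), zip_tape w [],
       zip_tape [] (zeros (Suc (Suc n))), zip_tape (zeros a) (Zero # zeros (length rs + b))]
      [zip_tape (u @ row_text x) (matrix_text rs @ v),
       zip_tape ((w @ entries [0, 0]) @ row_text (x @ replicate (n - length x) 0)) [],
       zip_tape [] (zeros (2 + length x + (n - length x))),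
       zip_tape (zeros a @ [Zero]) (zeros (length rs + b))]
      ((length (entries [0, 0]) + 3) +
       ((5 * length (entries x) + 10 * (2 + length x + (n - length x)) + 9) + 1))"
    by (rule runs_Seq[OF _ runs_Seq[OF runs_copy_row runs_right(3)]]) (use x in \<open>auto intro: runs_head[THEN runs_cong]\<close>)
  then have body: "runs (head 0 0 ;; copy_row ;; right 3)
      [zip_tape u (row_text x @ matrix_text rs @ v), zip_tape w [],
       zip_tape [] (zeros (Suc (Suc n))), zip_tape (zeros a) (zeros (Suc (length rs + b)))]
      [zip_tape (u @ row_text x) (matrix_text rs @ v),
       zip_tape (w @ row_text ([0, 0] @ x @ replicate (n - length x) 0)) [],
       zip_tape [] (zeros (Suc (Suc n))),
       zip_tape (zeros (Suc a)) (zeros (length rs + b))]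
      (5 * L + 10 * n + 49)"
    by (rule runs_cong)
      (use x in \<open>auto simp: row_text_append replicate_append_same\<close>)
  obtain y ys where y: "row_text x @ matrix_text rs @ v = y # ys" "y \<noteq> Bar"
    by (rule row_text_not_Bar)
  have "runs (Loop (\<lambda>ss. ss ! 0 \<noteq> Some Bar) (head 0 0 ;; copy_row ;; right 3))
     [zip_tape u (row_text x @ matrix_text rs @ v), zip_tape w [], zip_tape [] (zeros (Suc (Suc n))),
      zip_tape (zeros a) (zeros (Suc (length rs + b)))]
     [zip_tape ((u @ row_text x) @ concat (map row_text rs)) (Bar # v),
      zip_tape ((w @ row_text ([0, 0] @ x @ replicate (n - length x) 0)) @
        concat (map (\<lambda>r. row_text ([0, 0] @ r @ replicate (n - length r) 0)) rs)) [],
      zip_tape [] (zeros (Suc (Suc n))), zip_tape (zeros (Suc a + length rs)) (zeros b)]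
     (Suc ((5 * L + 10 * n + 49) + (length rs * (5 * L + 10 * n + 50) + 1)))"
    by (rule runs_Loop_True[OF _ body Cons.IH]) (use Cons.prems y in simp_all)
  then show ?case by (auto simp: matrix_text_def elim: runs_weaken)
qed

lemma runs_fill_rows:
  "runs (Loop (\<lambda>ss. ss ! 3 \<noteq> None) (fill_row ;; right 3))
     [a, zip_tape w [], zip_tape [] (zeros n), zip_tape u (zeros b)]
     [a, zip_tape (w @ concat (replicate b (row_text (replicate n 0)))) [],
      zip_tape [] (zeros n), zip_tape (u @ zeros b) []]
     (b * (10 * n + 9) + 1)"
proof (induction b arbitrary: w u)
  case 0
  show ?case by (simp add: runs_Loop_False[THEN runs_weaken])
next
  case (Suc b)
  have "runs (fill_row ;; right 3)
     [a, zip_tape w [], zip_tape [] (zeros n), zip_tape u (Zero # zeros b)]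
     [a, zip_tape (w @ row_text (replicate n 0)) [], zip_tape [] (zeros n), zip_tape (u @ [Zero]) (zeros b)]
     (10 * n + 8)"
    by (rule runs_Seq[OF runs_fill_row runs_right(3), THEN runs_cong]) (auto simp: digit_def)
  then show ?case
    by (intro runs_Loop_True[OF _ _ Suc.IH, THEN runs_cong]) (auto simp: numeral_eq_Suc)
qed

text \<open>The length of the matrix text bounds both the number of rows and the text of each row;
  this makes the row ruler long enough and the time quadratic in \<open>n\<close>. The 7 covers
  \<open>e = 0\<close> and \<open>e = 1\<close>, so that the time does not depend on
  \<open>e\<close>.\<close>

lemma runs_copy_matrix:
  assumes n: "length (matrix_text rs) + 2 \<le> n" and rs: "\<And>r. r \<in> set rs \<Longrightarrow> length r + 2 \<le> n"
    and e: "length (entries [0, e]) \<le> 7"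
  shows "runs (copy_matrix e)
     [zip_tape u (matrix_text rs @ v), zip_tape w [], zip_tape [] (zeros n), zip_tape [] (zeros n)]
     [zip_tape (u @ matrix_text rs) v, zip_tape (w @ matrix_text (pad_rows n e rs)) [],
      zip_tape [] (zeros n), zip_tape [] (zeros n)]
     (15 * n * n + 100 * n + 100)"
proof -
  define m where "m = n - 2"
  have n_eq: "n = Suc (Suc m)" using n by (simp add: m_def)
  define l where "l = length rs"
  \<comment> \<open>The number of zero rows at the bottom.\<close>
  define b where "b = m - l"
  have l: "m = l + b" using n length_matrix_text(1)[of rs] by (simp add: b_def m_def l_def)
  have rs': "length r \<le> m \<and> length (entries r) \<le> m" if "r \<in> set rs" for r
    using rs[OF that] n length_matrix_text(2)[OF that] unfolding m_def by linarith
  have "n \<ge> 2" using n by simp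
  let ?T = "[zip_tape [] (zeros n), zip_tape [] (zeros n)]"
  define w1 where "w1 = w @ row_text ([1, - 1] @ replicate m 0)"
  define w2 where "w2 = w1 @ row_text ([0, e] @ replicate m 0)"
  define w3 where "w3 = w2 @ concat (map (\<lambda>r. row_text ([0, 0] @ r @ replicate (m - length r) 0)) rs)"
  define w4 where "w4 = w3 @ concat (replicate b (row_text (replicate n 0)))"
  define i where "i = zip_tape u (matrix_text rs @ v)"
  have r1: "runs (top_row 1 (- 1)) (i # zip_tape w [] # ?T) (i # zip_tape w1 [] # ?T) (10 * n + 19)"
    by (rule runs_top_row[OF \<open>n \<ge> 2\<close>, THEN runs_cong]) (auto simp: w1_def m_def)
  have r2: "runs (top_row 0 e) (i # zip_tape w1 [] # ?T) (i # zip_tape w2 [] # ?T) (10 * n + 17)"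
    by (rule runs_top_row[OF \<open>n \<ge> 2\<close>, THEN runs_cong]) (use e in \<open>auto simp: w2_def m_def\<close>)
  have r3: "runs (right 3) (i # zip_tape w2 [] # ?T)
      [i, zip_tape w2 [], zip_tape [] (zeros n), zip_tape (zeros 1) (Zero # zeros m)] 1"
    by (rule runs_right(3)[THEN runs_cong]) (auto simp: n_eq)
  have r4: "runs (right 3) [i, zip_tape w2 [], zip_tape [] (zeros n), zip_tape (zeros 1) (Zero # zeros m)]
      [i, zip_tape w2 [], zip_tape [] (zeros n), zip_tape (zeros 2) (zeros (length rs + b))] 1"
    by (rule runs_right(3)[THEN runs_cong]) (auto simp: l l_def numeral_eq_Suc)
  have r5: "runs (Loop (\<lambda>ss. ss ! 0 \<noteq> Some Bar) (head 0 0 ;; copy_row ;; right 3))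
      [i, zip_tape w2 [], zip_tape [] (zeros n), zip_tape (zeros 2) (zeros (length rs + b))]
      [zip_tape (u @ concat (map row_text rs)) (Bar # v), zip_tape w3 [], zip_tape [] (zeros n),
       zip_tape (zeros (2 + l)) (zeros b)]
      (l * (15 * m + 50) + 1)"
    unfolding i_def n_eq
    by (rule runs_copy_rows[where n = m and L = m, THEN runs_cong]) (use rs' in \<open>auto simp: w3_def l_def\<close>)
  have r6: "runs (right 0)
      [zip_tape (u @ concat (map row_text rs)) (Bar # v), zip_tape w3 [], zip_tape [] (zeros n),
       zip_tape (zeros (2 + l)) (zeros b)]
      [zip_tape (u @ matrix_text rs) v, zip_tape w3 [], zip_tape [] (zeros n),
       zip_tape (zeros (2 + l)) (zeros b)] 1"
    by (rule runs_right(1)[THEN runs_cong]) (auto simp: matrix_text_def)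
  have r7: "runs (rewind 3)
      [zip_tape (u @ matrix_text rs) v, zip_tape (w4 @ [Bar]) [], zip_tape [] (zeros n),
       zip_tape (zeros (2 + l) @ zeros b) []]
      [zip_tape (u @ matrix_text rs) v, zip_tape (w4 @ [Bar]) [], zip_tape [] (zeros n),
       zip_tape [] (zeros n)] (2 * n + 5)"
    by (rule runs_rewind3[THEN runs_cong]) (auto simp: n_eq l replicate_add numeral_eq_Suc)
  have w4: "w4 @ [Bar] = w @ matrix_text (pad_rows n e rs)"
    by (simp add: w4_def w3_def w2_def w1_def matrix_text_def pad_rows_def m_def b_def l_def o_def)
  \<comment> \<open>Copied rows and zero rows together number \<open>m\<close>, so a common cost per
    row suffices.\<close>
  have "l * (15 * m + 50) + b * (10 * n + 9) \<le> l * (15 * n + 50) + b * (15 * n + 50)"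
    by (intro add_mono mult_left_mono) (auto simp: n_eq)
  also have "\<dots> = m * (15 * n + 50)" by (simp add: l algebra_simps)
  also have "\<dots> \<le> n * (15 * n + 50)" by (intro mult_right_mono) (auto simp: n_eq)
  finally have time: "l * (15 * m + 50) + b * (10 * n + 9) \<le> 15 * n * n + 50 * n"
    by (simp add: algebra_simps)
  show ?thesis
    unfolding copy_matrix_def
    by (rule runs_Seq[OF r1 runs_Seq[OF r2 runs_Seq[OF r3 runs_Seq[OF r4 runs_Seq[OF r5 runs_Seq[OF r6
          runs_Seq[OF runs_fill_rows runs_Seq[OF runs_emit(1) r7[unfolded w4_def]]]]]]]], THEN runs_cong])
      (use time w4 in \<open>auto simp: i_def w4_def\<close>)
qed

section \<open>Writing the identity matrix\<close>

definition mark :: prog where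
  "mark = Act 2 (\<lambda>_. (Some One, Stay))"

definition identity_rows :: "nat \<Rightarrow> rat list list" where
  "identity_rows n = map (\<lambda>i. replicate i 0 @ 1 # replicate (n - Suc i) 0) [0..<n]"

text \<open>The only \<^const>\<open>One\<close> on tape 2 marks the diagonal entry of the row that is written next.\<close>

definition emit_identity :: prog where
  "emit_identity =
     mark ;;
     Loop (\<lambda>ss. ss ! 2 \<noteq> None)
       (rewind 2 ;; fill_row ;; Loop (\<lambda>ss. ss ! 2 \<noteq> Some One) (right 2) ;; emit 2 Zero ;;
        Cond (\<lambda>ss. ss ! 2 = None) skip mark) ;;
     rewind 2 ;; emit 1 Bar"

lemma runs_mark:
  "runs mark (a # b # zip_tape u (x # v) # r) (a # b # zip_tape u (One # v) # r) 1"
  unfolding mark_def by (rule runs_Act') (simp add: numeral_eq_Suc)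

lemma runs_overwrite:
  "runs (emit 2 x) (a # b # zip_tape u (y # v) # r) (a # b # zip_tape (u @ [x]) v # r) 1"
  unfolding emit_def by (rule runs_Act') (simp add: numeral_eq_Suc)

lemma runs_find_One:
  "runs (Loop (\<lambda>ss. ss ! 2 \<noteq> Some One) (right 2)) (a # b # zip_tape u (zeros i @ One # v) # r)
     (a # b # zip_tape (u @ zeros i) (One # v) # r) (2 * i + 1)"
proof (induction i arbitrary: u)
  case 0
  show ?case by (simp add: runs_Loop_False[THEN runs_weaken])
next
  case (Suc i)
  show ?case
    by (rule runs_Loop_True[OF _ runs_right(2) Suc.IH, THEN runs_cong]) auto
qed

text \<open>Tape 2 from the marked cell on, with \<open>j\<close> rows still to be written; it is
  empty once the mark has left the ruler, which ends the loop.\<close>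

definition mark_tail :: "nat \<Rightarrow> symbol list" where
  "mark_tail j = (case j of 0 \<Rightarrow> [] | Suc j \<Rightarrow> One # zeros j)"

lemma runs_emit_identity:
  assumes n: "n > 0"
  shows "runs emit_identity (a # zip_tape w [] # zip_tape [] (zeros n) # r)
     (a # zip_tape (w @ matrix_text (identity_rows n)) [] # zip_tape [] (zeros n) # r)
     (15 * n * n + 25 * n + 8)"
proof -
  let ?b = "rewind 2 ;; fill_row ;; Loop (\<lambda>ss. ss ! 2 \<noteq> Some One) (right 2) ;; emit 2 Zero ;;
        Cond (\<lambda>ss. ss ! 2 = None) skip mark"
  let ?row = "\<lambda>i. row_text (replicate i 0 @ 1 # replicate (n - Suc i) 0)"
  \<comment> \<open>One pass: with the mark at position \<open>i\<close>, row \<open>i\<close> is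
    written and the mark moves one cell to the right.\<close>
  have body: "runs ?b (a # zip_tape w [] # zip_tape (zeros i) (mark_tail (Suc j)) # r)
      (a # zip_tape (w @ ?row i) [] # zip_tape (zeros (Suc i)) (mark_tail j) # r) (14 * n + 22)"
    if "i + Suc j = n" for i j w
  proof -
    \<comment> \<open>The old mark has been erased and the head is on the next cell; for
      \<open>j = 0\<close> this is the blank behind the ruler, and no new mark is set.\<close>
    have c: "runs (Cond (\<lambda>ss. ss ! 2 = None) skip mark)
        (a # zip_tape (w @ ?row i) [] # zip_tape (([] @ zeros i) @ [Zero]) (zeros j) # r)
        (a # zip_tape (w @ ?row i) [] # zip_tape (zeros (Suc i)) (mark_tail j) # r) (Suc 1)"
    proof (cases j)
      case 0
      show ?thesis
        by (rule runs_Cond_True[OF _ runs_skip[THEN runs_cong]])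
          (auto simp: 0 mark_tail_def replicate_append_same)
    next
      case (Suc j')
      show ?thesis
        by (rule runs_Cond_False[OF _ runs_mark[THEN runs_cong]])
          (auto simp: Suc mark_tail_def replicate_append_same)
    qed
    have f: "runs fill_row (a # zip_tape w [] # zip_tape [] (zeros i @ One # zeros j) # r)
       (a # zip_tape (w @ ?row i) [] # zip_tape [] (zeros i @ One # zeros j) # r) (10 * n + 7)"
      using that by (intro runs_fill_row[THEN runs_cong]) (auto simp: digit_def)
    have rw: "runs (rewind 2) (a # zip_tape w [] # zip_tape (zeros i) (mark_tail (Suc j)) # r)
       (a # zip_tape w [] # zip_tape [] (zeros i @ One # zeros j) # r) (2 * i + 5)"
      by (rule runs_rewind2[THEN runs_cong]) (auto simp: mark_tail_def)
    show ?thesis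
      by (rule runs_Seq[OF rw runs_Seq[OF f runs_Seq[OF runs_find_One runs_Seq[OF runs_overwrite c]]],
            THEN runs_cong]) (use that in auto)
  qed
  have loop: "runs (Loop (\<lambda>ss. ss ! 2 \<noteq> None) ?b) (a # zip_tape w [] # zip_tape (zeros i) (mark_tail j) # r)
      (a # zip_tape (w @ concat (map ?row [i..<n])) [] # zip_tape (zeros n) [] # r) (j * (14 * n + 23) + 1)"
    if "i + j = n" for i j w
    using that
  proof (induction j arbitrary: i w)
    case 0
    then show ?case by (simp add: mark_tail_def runs_Loop_False[THEN runs_weaken])
  next
    case (Suc j)
    have j: "Suc i + j = n" using Suc.prems by simp
    show ?case
      by (rule runs_Loop_True[OF _ body[OF Suc.prems] Suc.IH[OF j], THEN runs_cong])
        (use Suc.prems in \<open>auto simp: mark_tail_def upt_conv_Cons\<close>)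
  qed
  have m: "runs mark (a # zip_tape w [] # zip_tape [] (zeros n) # r)
      (a # zip_tape w [] # zip_tape (zeros 0) (mark_tail n) # r) 1"
    using n by (cases n) (auto simp: mark_tail_def intro!: runs_mark[unfolded One_nat_def])
  show ?thesis unfolding emit_identity_def
    by (rule runs_Seq[OF m runs_Seq[OF loop runs_Seq[OF runs_rewind2 runs_emit(1)]], THEN runs_cong])
      (auto simp: matrix_text_def identity_rows_def o_def algebra_simps)
qed

section \<open>Preparing the rulers and incrementing a binary number\<close>

definition prepare :: prog where
  "prepare =
     Loop (\<lambda>ss. ss ! 0 \<noteq> None) (emit 2 Zero ;; emit 3 Zero ;; right 0) ;;
     rewind 0 ;; rewind 2 ;; rewind 3"

text \<open>The input length in unary, on tape 2 as the ruler for columns and on tape 3 as the ruler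
  for rows.\<close>

lemma runs_prepare:
  "runs prepare [zip_tape [] x, b, zip_tape [] [], zip_tape [] []]
     [zip_tape [] x, b, zip_tape [] (zeros (length x)), zip_tape [] (zeros (length x))]
     (10 * length x + 16)"
proof -
  have loop: "runs (Loop (\<lambda>ss. ss ! 0 \<noteq> None) (emit 2 Zero ;; emit 3 Zero ;; right 0))
      [zip_tape u v, b, zip_tape (zeros l) [], zip_tape (zeros l) []]
      [zip_tape (u @ v) [], b, zip_tape (zeros (l + length v)) [], zip_tape (zeros (l + length v)) []]
      (4 * length v + 1)" for u v l
  proof (induction v arbitrary: u l)
    case Nil
    show ?case by (simp add: runs_Loop_False[THEN runs_weaken])
  next
    case (Cons x v)
    have body: "runs (emit 2 Zero ;; emit 3 Zero ;; right 0)
      [zip_tape u (x # v), b, zip_tape (zeros l) [], zip_tape (zeros l) []]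
      [zip_tape (u @ [x]) v, b, zip_tape (zeros (Suc l)) [], zip_tape (zeros (Suc l)) []] 3"
      by (rule runs_Seq[OF runs_emit(2) runs_Seq[OF runs_emit(3) runs_right(1)], THEN runs_cong])
        (auto simp: replicate_append_same)
    show ?case
      by (rule runs_Loop_True[OF _ body Cons.IH, THEN runs_cong]) auto
  qed
  show ?thesis unfolding prepare_def
    by (rule runs_Seq[OF loop[where l = 0] runs_Seq[OF runs_rewind0 runs_Seq[OF runs_rewind2 runs_rewind3]],
          THEN runs_cong]) auto
qed

text \<open>Increment with the least significant bit first: leading ones become zeros, the next zero
  or the end of the number becomes a one, and the rest up to the \<open>Bar\<close> is
  copied.\<close>

definition emit_succ :: prog where
  "emit_succ =
     Loop (\<lambda>ss. ss ! 0 = Some One) (emit 1 Zero ;; right 0) ;;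
     Cond (\<lambda>ss. ss ! 0 = Some Zero) (right 0) skip ;; emit 1 One ;; copy_until (Some Bar)"

lemma bits_double: "n > 0 \<Longrightarrow> bits (2 * n) = Zero # bits n"
  by (simp add: bits_pos)

text \<open>The two ways in which a carry ends: by running past the last bit or by meeting a
  \<open>Zero\<close>. For odd \<open>k\<close> one more \<open>One\<close> goes in front of the
  decomposition for \<open>k div 2\<close>.\<close>

lemma bits_decomp:
  obtains (Ones) a where "bits k = replicate a One" "bits (Suc k) = zeros a @ [One]"
  | (Zero) a j where "bits k = replicate a One @ Zero # bits j" "bits (Suc k) = zeros a @ One # bits j"
proof (induction k arbitrary: thesis rule: less_induct)
  case (less k)
  show ?case
  proof (cases "even k")
    case True
    then obtain j where k: "k = 2 * j" by blast
    show ?thesis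
    proof (cases "j = 0")
      case True
      \<comment> \<open>Here \<open>k = 0\<close>, whose empty string belongs to the first case with
        \<open>a = 0\<close>.\<close>
      then show ?thesis using less(2)[of 0] k by simp
    next
      case False
      then show ?thesis using less(3)[of 0 j] k bits_double[of j] bits_odd[of j] by simp
    qed
  next
    case False
    then obtain j where k: "k = 2 * j + 1" by (blast elim: oddE)
    have suc: "bits (Suc k) = Zero # bits (Suc j)" using bits_double[of "Suc j"] k by simp
    have bk: "bits k = One # bits j" using k bits_odd by simp
    show ?thesis
    proof (rule less.IH[of j])
      show "j < k" using k by simp
      show thesis if "bits j = replicate a One" "bits (Suc j) = zeros a @ [One]" for a
        using less(2)[of "Suc a"] that suc bk by simp
      show thesis if "bits j = replicate a One @ Zero # bits i" "bits (Suc j) = zeros a @ One # bits i"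
        for a i
        using less(3)[of "Suc a" i] that suc bk by simp
    qed
  qed
qed

lemma runs_emit_succ:
  "runs emit_succ (zip_tape [] (bits k @ Bar # v) # zip_tape w [] # r)
     (zip_tape (bits k) (Bar # v) # zip_tape (w @ bits (Suc k)) [] # r) (4 * length (bits k) + 10)"
proof -
  have ones: "runs (Loop (\<lambda>ss. ss ! 0 = Some One) (emit 1 Zero ;; right 0))
      (zip_tape u (replicate a One @ y # v) # zip_tape w [] # r)
      (zip_tape (u @ replicate a One) (y # v) # zip_tape (w @ zeros a) [] # r) (3 * a + 1)"
    if "y \<noteq> One" for u w a y v
  proof (induction a arbitrary: u w)
    case 0
    show ?case using that by (simp add: runs_Loop_False[THEN runs_weaken])
  next
    case (Suc a)
    show ?case
      by (rule runs_Loop_True[OF _ runs_Seq[OF runs_emit(1) runs_right(1)] Suc.IH, THEN runs_cong]) auto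
  qed
  show ?thesis
  proof (cases rule: bits_decomp[of k])
    case (Ones a)
    \<comment> \<open>Nothing is left to copy: the head is already on the
      \<open>Bar\<close>.\<close>
    have c: "runs (copy_until (Some Bar)) (zip_tape ([] @ replicate a One) (Bar # v) # zip_tape ((w @ zeros a) @ [One]) [] # r)
       (zip_tape ([] @ replicate a One) (Bar # v) # zip_tape ((w @ zeros a) @ [One]) [] # r) 1"
      by (rule runs_copy_until[where xs = "[]", THEN runs_cong]) auto
    show ?thesis unfolding emit_succ_def
      by (rule runs_Seq[OF ones runs_Seq[OF runs_Cond_False[OF _ runs_skip] runs_Seq[OF runs_emit(1) c]],
            THEN runs_cong])
        (auto simp: Ones)
  next
    case (Zero a j)
    have "Bar \<notin> set (bits j)" using set_bits[of j] by blast
    then have c: "runs (copy_until (Some Bar))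
       (zip_tape (([] @ replicate a One) @ [Zero]) (bits j @ Bar # v) # zip_tape ((w @ zeros a) @ [One]) [] # r)
       (zip_tape (bits k) (Bar # v) # zip_tape (w @ bits (Suc k)) [] # r) (3 * length (bits j) + 1)"
      by (intro runs_copy_until[THEN runs_cong]) (auto simp: Zero)
    show ?thesis unfolding emit_succ_def
      by (rule runs_Seq[OF ones runs_Seq[OF runs_Cond_True[OF _ runs_right(1)] runs_Seq[OF runs_emit(1) c]],
            THEN runs_cong])
        (auto simp: Zero)
  qed
qed

section \<open>The complete reduction program and its running time\<close>

definition reduce :: prog where
  "reduce =
     prepare ;; emit_succ ;; emit 1 Bar ;; rewind 0 ;; emit_succ ;;
     emits ([Slash, One, Comma] @ entries [1]) ;; right 2 ;; right 2 ;; right 0 ;; copy_row ;;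
     emit_identity ;; copy_matrix 0 ;; Loop (\<lambda>ss. ss ! 0 \<noteq> None) (copy_matrix 1)"

lemma matrix_text_nonempty:
  obtains x xs where "matrix_text rs @ v = x # xs"
  by (cases "matrix_text rs @ v") (auto simp: matrix_text_def)

lemma runs_copy_matrices:
  assumes "\<And>rs. rs \<in> set Rs \<Longrightarrow> length (matrix_text rs) + 2 \<le> n"
    and "\<And>rs r. rs \<in> set Rs \<Longrightarrow> r \<in> set rs \<Longrightarrow> length r + 2 \<le> n"
  shows "runs (Loop (\<lambda>ss. ss ! 0 \<noteq> None) (copy_matrix 1))
     [zip_tape u (concat (map matrix_text Rs)), zip_tape w [], zip_tape [] (zeros n), zip_tape [] (zeros n)]
     [zip_tape (u @ concat (map matrix_text Rs)) [],
      zip_tape (w @ concat (map (\<lambda>rs. matrix_text (pad_rows n 1 rs)) Rs)) [],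
      zip_tape [] (zeros n), zip_tape [] (zeros n)]
     (length Rs * (15 * n * n + 100 * n + 101) + 1)"
  using assms
proof (induction Rs arbitrary: u w)
  case Nil
  show ?case by (simp add: runs_Loop_False[THEN runs_weaken])
next
  case (Cons rs Rs)
  obtain x xs where x: "matrix_text rs @ concat (map matrix_text Rs) = x # xs"
    by (rule matrix_text_nonempty)
  have m: "runs (copy_matrix 1)
     [zip_tape u (matrix_text rs @ concat (map matrix_text Rs)), zip_tape w [],
      zip_tape [] (zeros n), zip_tape [] (zeros n)]
     [zip_tape (u @ matrix_text rs) (concat (map matrix_text Rs)),
      zip_tape (w @ matrix_text (pad_rows n 1 rs)) [], zip_tape [] (zeros n), zip_tape [] (zeros n)]
     (15 * n * n + 100 * n + 100)"
    by (rule runs_copy_matrix) (use Cons.prems in auto)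
  have "runs (Loop (\<lambda>ss. ss ! 0 \<noteq> None) (copy_matrix 1))
     [zip_tape u (matrix_text rs @ concat (map matrix_text Rs)), zip_tape w [],
      zip_tape [] (zeros n), zip_tape [] (zeros n)]
     [zip_tape ((u @ matrix_text rs) @ concat (map matrix_text Rs)) [],
      zip_tape ((w @ matrix_text (pad_rows n 1 rs)) @ concat (map (\<lambda>rs. matrix_text (pad_rows n 1 rs)) Rs)) [],
      zip_tape [] (zeros n), zip_tape [] (zeros n)]
     (Suc ((15 * n * n + 100 * n + 100) + (length Rs * (15 * n * n + 100 * n + 101) + 1)))"
    by (rule runs_Loop_True[OF _ m Cons.IH]) (use Cons.prems x in auto)
  then show ?case by (rule runs_cong) (simp_all add: algebra_simps)
qed

text \<open>\<open>emit_succ\<close> runs twice, for the new length and for the numerator of the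
  first coordinate. Since an encoding lists the selector before the transforms, writing the identity
  first and then padding the rest in order makes the padded selector the first matrix of the new
  list.\<close>

lemma runs_reduce:
  fixes k xs S Rs
  defines "x \<equiv> bits k @ Bar # row_text xs @ matrix_text S @ concat (map matrix_text Rs)"
  defines "n \<equiv> length x"
  assumes r: "\<And>r. r \<in> set S \<Longrightarrow> length r \<le> length xs"
    "\<And>rs r. rs \<in> set Rs \<Longrightarrow> r \<in> set rs \<Longrightarrow> length r \<le> length xs"
    and xs: "xs \<noteq> []" and S: "S \<noteq> []"
  shows "\<exists>s. runs reduce [zip_tape [] x, zip_tape [] [], zip_tape [] [], zip_tape [] []]
     (s # zip_tape (bits (Suc k) @ Bar # row_text ([of_nat (Suc k), 1] @ xs @ replicate (n - 2 - length xs) 0) @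
        matrix_text (identity_rows n) @ matrix_text (pad_rows n 0 S) @
        concat (map (\<lambda>rs. matrix_text (pad_rows n 1 rs)) Rs)) [] # 
      [zip_tape [] (zeros n), zip_tape [] (zeros n)])
     (n ^ 6)"
proof -
  define y where "y = row_text xs @ matrix_text S @ concat (map matrix_text Rs)"
  define z where "z = matrix_text S @ concat (map matrix_text Rs)"
  have x: "x = bits k @ Bar # y" by (simp add: x_def y_def)
  have yz: "y = row_text xs @ z" by (simp add: y_def z_def)
  have len_row: "length (row_text xs) = length (entries xs) + 1" by (simp add: row_text_def)
  have n: "n = length (bits k) + 1 + (length (entries xs) + 1) + length (matrix_text S) +
      sum_list (map (length \<circ> matrix_text) Rs)"
    by (simp add: n_def x_def len_row length_concat o_def)
  have e: "length xs \<le> length (entries xs)" by (rule length_entries_ge)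
  have lS: "length (matrix_text S) \<ge> 2" using S by (cases S) (auto simp: matrix_text_def row_text_def)
  have lR: "length (matrix_text rs) + 2 \<le> n" if "rs \<in> set Rs" for rs
    using member_le_sum_list[of "length (matrix_text rs)" "map (length \<circ> matrix_text) Rs"] that
    by (auto simp: n)
  have mR: "length Rs \<le> n"
  proof -
    have "length Rs \<le> sum_list (map (length \<circ> matrix_text) Rs)"
      by (induction Rs) (auto simp: matrix_text_def)
    then show ?thesis by (simp add: n)
  qed
  have n2: "n \<ge> length xs + 2" using e lS n by linarith
  have eN: "length (entries xs) \<le> n" "length (bits k) \<le> n" using n by linarith+
  \<comment> \<open>A nonempty vector and a nonempty selector force at least six symbols, which the
    final time estimate uses.\<close>
  have "length (entries xs) \<ge> 2" using xs by (cases xs) (auto simp: enc_rat_def split: prod.splits)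
  then have n_ge: "n \<ge> 6" using n lS by linarith
  define m where "m = n - 2 - length xs"
  have nm: "n = Suc (Suc (length xs + m))" using n2 by (simp add: m_def)
  let ?T = "[zip_tape [] (zeros n), zip_tape [] (zeros n)]"
  define w1 where "w1 = bits (Suc k) @ [Bar]"
  define w2 where "w2 = w1 @ bits (Suc k) @ [Slash, One, Comma] @ entries [1]"
  define w3 where "w3 = w2 @ row_text (xs @ replicate m 0)"
  define w4 where "w4 = w3 @ matrix_text (identity_rows n)"
  define w5 where "w5 = w4 @ matrix_text (pad_rows n 0 S)"
  define u where "u = bits k @ [Bar]"
  have r1: "runs prepare [zip_tape [] x, zip_tape [] [], zip_tape [] [], zip_tape [] []]
      (zip_tape [] (bits k @ Bar # y) # zip_tape [] [] # ?T) (10 * n + 16)"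
    using runs_prepare[of x] by (simp add: x[symmetric] n_def)
  have r2: "runs emit_succ (zip_tape [] (bits k @ Bar # y) # zip_tape [] [] # ?T)
      (zip_tape (bits k) (Bar # y) # zip_tape (bits (Suc k)) [] # ?T) (4 * n + 10)"
    by (rule runs_emit_succ[THEN runs_cong]) (use eN in auto)
  have r3: "runs (emit 1 Bar) (zip_tape (bits k) (Bar # y) # zip_tape (bits (Suc k)) [] # ?T)
      (zip_tape (bits k) (Bar # y) # zip_tape w1 [] # ?T) 1"
    by (rule runs_emit(1)[THEN runs_cong]) (auto simp: w1_def)
  have r4: "runs (rewind 0) (zip_tape (bits k) (Bar # y) # zip_tape w1 [] # ?T)
      (zip_tape [] (bits k @ Bar # y) # zip_tape w1 [] # ?T) (2 * n + 5)"
    by (rule runs_rewind0[where u = "bits k" and v = "Bar # y", THEN runs_cong]) (use eN in auto)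
  have r5: "runs emit_succ (zip_tape [] (bits k @ Bar # y) # zip_tape w1 [] # ?T)
      (zip_tape (bits k) (Bar # y) # zip_tape (w1 @ bits (Suc k)) [] # ?T) (4 * n + 10)"
    by (rule runs_emit_succ[THEN runs_cong]) (use eN in auto)
  have r6: "runs (emits ([Slash, One, Comma] @ entries [1]))
      (zip_tape (bits k) (Bar # y) # zip_tape (w1 @ bits (Suc k)) [] # ?T)
      (zip_tape (bits k) (Bar # y) # zip_tape w2 [] # ?T) 8"
    by (rule runs_emits[THEN runs_cong]) (auto simp: w2_def)
  have r7: "runs (right 2) (zip_tape (bits k) (Bar # y) # zip_tape w2 [] # ?T)
      [zip_tape (bits k) (Bar # y), zip_tape w2 [], zip_tape (zeros 1) (Zero # zeros (length xs + m)),
       zip_tape [] (zeros n)] 1"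
    by (rule runs_right(2)[THEN runs_cong]) (auto simp: nm)
  have r8: "runs (right 2)
      [zip_tape (bits k) (Bar # y), zip_tape w2 [], zip_tape (zeros 1) (Zero # zeros (length xs + m)),
       zip_tape [] (zeros n)]
      [zip_tape (bits k) (Bar # y), zip_tape w2 [], zip_tape (zeros 2) (zeros (length xs + m)),
       zip_tape [] (zeros n)] 1"
    by (rule runs_right(2)[THEN runs_cong]) (auto simp: numeral_eq_Suc)
  have r9: "runs (right 0)
      [zip_tape (bits k) (Bar # y), zip_tape w2 [], zip_tape (zeros 2) (zeros (length xs + m)),
       zip_tape [] (zeros n)]
      [zip_tape u (row_text xs @ z), zip_tape w2 [], zip_tape (zeros 2) (zeros (length xs + m)),
       zip_tape [] (zeros n)] 1"
    by (rule runs_right(1)[THEN runs_cong]) (auto simp: u_def yz)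
  have r10: "runs copy_row
      [zip_tape u (row_text xs @ z), zip_tape w2 [], zip_tape (zeros 2) (zeros (length xs + m)),
       zip_tape [] (zeros n)]
      (zip_tape (u @ row_text xs) z # zip_tape w3 [] # ?T) (15 * n + 9)"
    by (rule runs_copy_row[THEN runs_cong]) (use eN in \<open>auto simp: w3_def nm\<close>)
  have r11: "runs emit_identity (zip_tape (u @ row_text xs) z # zip_tape w3 [] # ?T)
      (zip_tape (u @ row_text xs) z # zip_tape w4 [] # ?T) (15 * n * n + 25 * n + 8)"
    unfolding w4_def by (rule runs_emit_identity) (simp add: nm)
  have r12: "runs (copy_matrix 0) (zip_tape (u @ row_text xs) z # zip_tape w4 [] # ?T)
      (zip_tape (u @ row_text xs @ matrix_text S) (concat (map matrix_text Rs)) # zip_tape w5 [] # ?T)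
      (15 * n * n + 100 * n + 100)"
    unfolding z_def w5_def
    by (rule runs_copy_matrix[where rs = S and n = n and w = w4 and u = "u @ row_text xs"
          and v = "concat (map matrix_text Rs)", THEN runs_cong])
      (use n r(1) n2 in force)+
  have r13: "runs (Loop (\<lambda>ss. ss ! 0 \<noteq> None) (copy_matrix 1))
      (zip_tape (u @ row_text xs @ matrix_text S) (concat (map matrix_text Rs)) # zip_tape w5 [] # ?T)
      (zip_tape x [] # zip_tape (w5 @ concat (map (\<lambda>rs. matrix_text (pad_rows n 1 rs)) Rs)) [] # ?T)
      (length Rs * (15 * n * n + 100 * n + 101) + 1)"
    by (rule runs_copy_matrices[where Rs = Rs and n = n, THEN runs_cong])
      (use lR r(2) n2 in \<open>force simp: u_def x_def\<close>)+
  have w: "w5 @ concat (map (\<lambda>rs. matrix_text (pad_rows n 1 rs)) Rs) =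
      bits (Suc k) @ Bar # row_text ([of_nat (Suc k), 1] @ xs @ replicate (n - 2 - length xs) 0) @
        matrix_text (identity_rows n) @ matrix_text (pad_rows n 0 S) @
        concat (map (\<lambda>rs. matrix_text (pad_rows n 1 rs)) Rs)"
    using enc_rat_of_nat[of "Suc k"]
    by (simp add: w5_def w4_def w3_def w2_def w1_def row_text_append m_def)
  have matrices: "length Rs * (15 * n * n + 100 * n + 101) \<le> 15 * n * n * n + 100 * n * n + 101 * n"
    using mult_right_mono[OF mR, of "15 * n * n + 100 * n + 101"] by (simp add: algebra_simps)
  \<comment> \<open>The left side is the sum of the bounds of all stages.\<close>
  have "15 * n * n * n + 130 * n * n + 261 * n + 171 \<le> 46 * n ^ 3"
  proof -
    have "6 * n ^ 2 \<le> n * n ^ 2" using n_ge by (intro mult_right_mono) auto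
    moreover have "6 * n \<le> n * n" using n_ge by (intro mult_right_mono) auto
    ultimately have "130 * n ^ 2 + 261 * n + 171 \<le> 31 * n ^ 3"
      using n_ge unfolding power3_eq_cube power2_eq_square mult.assoc by linarith
    then show ?thesis by (simp add: power3_eq_cube power2_eq_square mult.assoc)
  qed
  \<comment> \<open>The exponent 6 absorbs the constant, as 46 is below the cube of 6. No constant
    may be left over because the chosen factor \<open>2 * k + 1\<close> is 1 for
    \<open>k = 0\<close>.\<close>
  also have "\<dots> \<le> n ^ 6"
  proof -
    have "(6::nat) ^ 3 \<le> n ^ 3" using n_ge by (rule power_mono) simp
    then have "46 * n ^ 3 \<le> n ^ 3 * n ^ 3" by (intro mult_right_mono) auto
    then show ?thesis by (simp add: power_add[symmetric])
  qed
  finally have total: "15 * n * n * n + 130 * n * n + 261 * n + 171 \<le> n ^ 6" .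
  show ?thesis
    unfolding reduce_def
    by (rule exI, rule runs_Seq[OF r1 runs_Seq[OF r2 runs_Seq[OF r3 runs_Seq[OF r4 runs_Seq[OF r5
          runs_Seq[OF r6 runs_Seq[OF r7 runs_Seq[OF r8 runs_Seq[OF r9 runs_Seq[OF r10 runs_Seq[OF r11
          runs_Seq[OF r12 r13]]]]]]]]]]], THEN runs_cong, OF refl])
      (simp only: w, use matrices total in linarith)
qed

section \<open>Correctness of the padding\<close>

definition pad_vec :: "nat \<Rightarrow> rat \<Rightarrow> rat \<Rightarrow> rat vec \<Rightarrow> rat vec" where
  "pad_vec n a b w = vec_of_list ([a, b] @ list_of_vec w @ replicate (n - 2 - dim_vec w) 0)"

text \<open>Built from the very rows that the machine writes, so the encoding of a padded matrix is
  immediate and only the product needs linear algebra.\<close>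

definition pad_mat :: "nat \<Rightarrow> rat \<Rightarrow> rat mat \<Rightarrow> rat mat" where
  "pad_mat n e A = mat_of_rows_list n (pad_rows n e (map list_of_vec (rows A)))"

lemma vec_of_list_zeros: "vec_of_list (replicate k 0) = 0\<^sub>v k"
  by (intro eq_vecI) (auto simp: vec_of_list_index)

lemma vec_of_list_append: "vec_of_list (xs @ ys) = vec_of_list xs @\<^sub>v vec_of_list ys"
  by (intro eq_vecI) (auto simp: vec_of_list_index nth_append)

lemma pad_vec_zero: "h + 2 \<le> n \<Longrightarrow> pad_vec n 0 0 (0\<^sub>v h) = 0\<^sub>v n"
proof -
  assume "h + 2 \<le> n"
  then have "[0, 0] @ list_of_vec (0\<^sub>v h) @ replicate (n - 2 - dim_vec (0\<^sub>v h :: rat vec)) 0 = replicate n (0 :: rat)"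
    by (intro nth_equalityI) (auto simp: nth_Cons' nth_append list_of_vec_index)
  then show ?thesis by (simp only: pad_vec_def vec_of_list_zeros)
qed

text \<open>Turns a product into a list of scalar products, to match the form of
  \<open>pad_rows\<close>.\<close>

lemma mat_of_rows_list_mult:
  assumes "\<And>r. r \<in> set rs \<Longrightarrow> length r = n"
  shows "mat_of_rows_list n rs *\<^sub>v x = vec_of_list (map (\<lambda>r. vec_of_list r \<bullet> x) rs)"
proof (rule eq_vecI)
  fix i assume i: "i < dim_vec (vec_of_list (map (\<lambda>r. vec_of_list r \<bullet> x) rs))"
  then have i: "i < length rs" by simp
  then have "length (rs ! i) = n" using assms by simp
  then have "row (mat_of_rows_list n rs) i = vec_of_list (rs ! i)"
    using i by (intro eq_vecI) (auto simp: mat_of_rows_list_def vec_of_list_index)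
  then show "(mat_of_rows_list n rs *\<^sub>v x) $ i = vec_of_list (map (\<lambda>r. vec_of_list r \<bullet> x) rs) $ i"
    using i by (simp add: vec_of_list_index) (simp add: mat_of_rows_list_def)
qed (simp add: mat_of_rows_list_def)

lemma rows_mat_of_rows_list:
  assumes "\<And>r. r \<in> set rs \<Longrightarrow> length r = n"
  shows "map list_of_vec (rows (mat_of_rows_list n rs)) = rs"
proof (rule nth_equalityI)
  fix i assume "i < length (map list_of_vec (rows (mat_of_rows_list n rs)))"
  then have i: "i < length rs" by (simp add: mat_of_rows_list_def)
  then have "length (rs ! i) = n" using assms by simp
  then have "row (mat_of_rows_list n rs) i = vec_of_list (rs ! i)"
    using i by (intro eq_vecI) (auto simp: mat_of_rows_list_def vec_of_list_index)
  then show "map list_of_vec (rows (mat_of_rows_list n rs)) ! i = rs ! i"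
    using i by (simp add: list_vec mat_of_rows_list_def)
qed (simp add: mat_of_rows_list_def)

lemma enc_vec_row_text: "enc_vec = row_text \<circ> list_of_vec"
  by (rule ext) (simp add: enc_vec_def row_text_def entries_def)

lemma enc_mat_matrix_text: "enc_mat = matrix_text \<circ> (map list_of_vec \<circ> rows)"
  by (rule ext) (simp add: enc_mat_def matrix_text_def enc_vec_row_text)

lemma length_pad_rows: "length rs + 2 \<le> n \<Longrightarrow> length (pad_rows n e rs) = n"
  by (simp add: pad_rows_def)

lemma length_pad_rows_row:
  assumes "n \<ge> 2" "\<And>r. r \<in> set rs \<Longrightarrow> length r + 2 \<le> n" "r \<in> set (pad_rows n e rs)"
  shows "length r = n"
  using assms(1,3) assms(2) by (auto simp: pad_rows_def)

lemma rows_identity: "map list_of_vec (rows (1\<^sub>m n)) = identity_rows n"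
proof -
  have "list_of_vec (unit_vec n i) = replicate i 0 @ 1 # replicate (n - Suc i) (0 :: rat)" if "i < n" for i
    using that by (intro nth_equalityI) (auto simp: list_of_vec_index nth_append nth_Cons')
  then show ?thesis by (simp add: rows_def identity_rows_def)
qed

section \<open>A padded matrix acting on vectors\<close>

context
  fixes n d r :: nat and A :: "rat mat"
  assumes A: "A \<in> carrier_mat r d" and d: "d + 2 \<le> n" and r: "r + 2 \<le> n"
begin

lemma pad_mat_row_length:
  "x \<in> set (pad_rows n e (map list_of_vec (rows A))) \<Longrightarrow> length x = n"
  by (rule length_pad_rows_row) (use A d in \<open>auto simp: rows_def\<close>)

lemma pad_mat_carrier: "pad_mat n e A \<in> carrier_mat n n"
  using length_pad_rows[of "map list_of_vec (rows A)" n e] A r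
  by (simp add: pad_mat_def mat_of_rows_list_def)

lemma enc_pad_mat: "enc_mat (pad_mat n e A) = matrix_text (pad_rows n e (map list_of_vec (rows A)))"
  unfolding enc_mat_matrix_text pad_mat_def o_apply by (subst rows_mat_of_rows_list[OF pad_mat_row_length]) auto

text \<open>Block multiplication; used up to and including the first application of the selector,
  where \<open>w\<close> still has dimension \<open>d\<close>.\<close>

lemma pad_mat_mult:
  assumes w: "w \<in> carrier_vec d"
  shows "pad_mat n e A *\<^sub>v pad_vec n a b w = pad_vec n (a - b) (e * b) (A *\<^sub>v w)"
proof -
  define m where "m = n - 2"
  have n: "n = Suc (Suc m)" and m: "d \<le> m" using d by (auto simp: m_def)
  define y where "y = w @\<^sub>v 0\<^sub>v (m - d)"
  note z = vec_of_list_zeros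
  have y: "y \<in> carrier_vec m" using w m by (auto simp: y_def intro!: carrier_vecI)
  have x: "pad_vec n a b w = vCons a (vCons b y)"
    using w by (simp add: pad_vec_def y_def m_def[symmetric] vec_of_list_append z vec_list)
  have zy: "0\<^sub>v m \<bullet> y = 0" using y by simp
  have zx: "0\<^sub>v n \<bullet> vCons a (vCons b y) = 0" using y n by simp
  have row: "(row A i @\<^sub>v 0\<^sub>v (m - d)) \<bullet> y = row A i \<bullet> w" if "i < r" for i
    unfolding y_def using A w that by (subst scalar_prod_append[of _ d _ "m - d"]) auto
  have mid: "map ((\<lambda>x. vec_of_list x \<bullet> vCons a (vCons b y)) \<circ>
      ((\<lambda>r. 0 # 0 # r @ replicate (m - length r) 0) \<circ> list_of_vec)) (rows A) = list_of_vec (A *\<^sub>v w)"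
    using A row
    by (intro nth_equalityI) (auto simp: list_of_vec_index vec_of_list_append vec_list z)
  show ?thesis
    unfolding pad_mat_def
    using A zy zx mid
    by (subst mat_of_rows_list_mult[OF pad_mat_row_length])
      (auto simp: x pad_rows_def m_def[symmetric] z vec_of_list_append
        pad_vec_def[of n "a - b" "e * b" "A *\<^sub>v w"])
qed

text \<open>Needed for arbitrary vectors: the selector leaves a padded vector of dimension
  \<open>h\<close>, which may differ from \<open>d\<close>, so \<open>pad_mat_mult\<close> need not
  apply afterwards.\<close>

lemma pad_mat_mult_top:
  assumes x: "x \<in> carrier_vec n"
  shows "(pad_mat n e A *\<^sub>v x) $ 0 = x $ 0 - x $ 1" "(pad_mat n e A *\<^sub>v x) $ 1 = e * x $ 1"
proof -
  note z = vec_of_list_zeros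
  obtain a b ys where ys: "list_of_vec x = a # b # ys"
    using x d by (metis Suc_le_length_iff add_leD2 carrier_vecD length_list_of_vec numeral_2_eq_2)
  then have l: "n - 2 = length ys" using x by (metis carrier_vecD length_list_of_vec diff_Suc_Suc diff_zero length_Cons numeral_2_eq_2)
  have x': "x = vCons a (vCons b (vec_of_list ys))"
    using ys by (metis vec_list vec_of_list_Cons)
  have "0\<^sub>v (n - 2) \<bullet> vec_of_list ys = 0"
    unfolding l by (rule scalar_prod_left_zero) (simp add: carrier_vecI)
  then show "(pad_mat n e A *\<^sub>v x) $ 0 = x $ 0 - x $ 1" "(pad_mat n e A *\<^sub>v x) $ 1 = e * x $ 1"
    unfolding pad_mat_def
    by (subst mat_of_rows_list_mult[OF pad_mat_row_length]; simp add: pad_rows_def x' z)+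
qed

end

text \<open>There are finitely many words of a fixed length over finitely many indices, so
  \<open>card\<close> does not take its default value 0 on a nonempty set.\<close>

lemma vest_count_pos:
  "vest_count x > 0 \<longleftrightarrow>
     (\<exists>is. length is = seq_length x \<and> set is \<subseteq> {..<length (transforms x)} \<and>
        selector x *\<^sub>v apply_transforms (transforms x) is (start x) = 0\<^sub>v (dim_row (selector x)))"
proof -
  have "finite {is. length is = seq_length x \<and> set is \<subseteq> {..<length (transforms x)} \<and>
      selector x *\<^sub>v apply_transforms (transforms x) is (start x) = 0\<^sub>v (dim_row (selector x))}"
    by (rule finite_subset[OF _ finite_lists_length_eq[of "{..<length (transforms x)}" "seq_length x"]]) auto
  then show ?thesis by (auto simp: vest_count_def card_gt_0_iff)
qed

definition reduce_vest :: "vest \<Rightarrow> vest" where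
  "reduce_vest x =
     (let n = length (enc_vest x) in
      \<lparr>start = pad_vec n (of_nat (Suc (seq_length x))) 1 (start x),
       transforms = pad_mat n 0 (selector x) # map (pad_mat n 1) (transforms x),
       selector = 1\<^sub>m n, seq_length = Suc (seq_length x)\<rparr>)"

section \<open>Words over the padded matrices\<close>

lemma apply_transforms_simps [simp]:
  "apply_transforms Ts [] v = v"
  "apply_transforms Ts (i # is) v = apply_transforms Ts is ((Ts ! i) *\<^sub>v v)"
  "apply_transforms Ts (is @ js) v = apply_transforms Ts js (apply_transforms Ts is v)"
  by (simp_all add: apply_transforms_def)

lemma apply_transforms_carrier:
  assumes "\<And>T. T \<in> set Ts \<Longrightarrow> T \<in> carrier_mat d d" "set is \<subseteq> {..<length Ts}" "v \<in> carrier_vec d"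
  shows "apply_transforms Ts is v \<in> carrier_vec d"
  using assms(2,3)
proof (induction "is" arbitrary: v)
  case (Cons i js)
  then have "Ts ! i *\<^sub>v v \<in> carrier_vec d" using assms(1)[of "Ts ! i"] by auto
  then show ?case using Cons by simp
qed simp

context
  fixes n d h :: nat and S :: "rat mat" and Ts :: "rat mat list"
  assumes S: "S \<in> carrier_mat h d" and Ts: "\<And>T. T \<in> set Ts \<Longrightarrow> T \<in> carrier_mat d d"
    and d: "d + 2 \<le> n" and h: "h + 2 \<le> n"
begin

abbreviation "padded \<equiv> pad_mat n 0 S # map (pad_mat n 1) Ts"

lemma padded_carrier: "T \<in> set padded \<Longrightarrow> T \<in> carrier_mat n n"
  using pad_mat_carrier[OF S d h] pad_mat_carrier[OF Ts d d] by auto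

lemma padded_top:
  assumes "i < length padded" "x \<in> carrier_vec n"
  shows "(padded ! i *\<^sub>v x) $ 0 = x $ 0 - x $ 1"
    "(padded ! i *\<^sub>v x) $ 1 = (if i = 0 then 0 else x $ 1)"
  using assms pad_mat_mult_top[OF S d h, of x] pad_mat_mult_top[OF Ts d d, of "Ts ! (i - 1)" x]
  by (auto simp: nth_Cons')

text \<open>Once the second coordinate is 0 it stays 0 under every padded matrix, and subtracting it
  leaves the first coordinate alone.\<close>

lemma padded_stopped:
  assumes "set is \<subseteq> {..<length padded}" "x \<in> carrier_vec n" "x $ 1 = 0"
  shows "apply_transforms padded is x $ 0 = x $ 0"
  using assms
proof (induction "is" arbitrary: x)
  case (Cons i js)
  then have i: "i < length padded" by simp
  have "padded ! i *\<^sub>v x \<in> carrier_vec n"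
    using padded_carrier[OF nth_mem[OF i]] Cons.prems(2) by (rule mult_mat_vec_carrier)
  \<comment> \<open>The two \<open>nth\<close> rules are removed to keep \<open>padded ! i\<close>
    intact for \<open>padded_top\<close>.\<close>
  then show ?case using Cons padded_top[OF i Cons.prems(2)] by (simp del: nth_Cons_0 nth_Cons_Suc)
qed simp

text \<open>Indices are shifted by \<open>Suc\<close> because the padded selector occupies index 0;
  each transform lowers the first coordinate by the second, which stays 1.\<close>

lemma padded_running:
  assumes "set js \<subseteq> {..<length Ts}" "w \<in> carrier_vec d"
  shows "apply_transforms padded (map Suc js) (pad_vec n a 1 w) =
      pad_vec n (a - of_nat (length js)) 1 (apply_transforms Ts js w)"
  using assms
proof (induction js arbitrary: a w)
  case (Cons j js)
  then have j: "Ts ! j \<in> carrier_mat d d" by (intro Ts) auto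
  then have "Ts ! j *\<^sub>v w \<in> carrier_vec d" using Cons.prems by auto
  then show ?case using Cons pad_mat_mult[OF j d d Cons.prems(2), of 1 a 1]
    by (simp add: algebra_simps)
qed simp

lemma padded_zero_iff:
  assumes v: "v \<in> carrier_vec d"
  shows "(\<exists>is. length is = Suc k \<and> set is \<subseteq> {..<length padded} \<and>
        apply_transforms padded is (pad_vec n (of_nat (Suc k)) 1 v) = 0\<^sub>v n) \<longleftrightarrow>
     (\<exists>js. length js = k \<and> set js \<subseteq> {..<length Ts} \<and> S *\<^sub>v apply_transforms Ts js v = 0\<^sub>v h)"
    (is "?L \<longleftrightarrow> ?R")
proof
  let ?x = "pad_vec n (of_nat (Suc k)) 1 v"
  \<comment> \<open>From \<open>k + 1\<close>, the transforms subtract \<open>length js\<close> and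
    the selector step subtracts one more.\<close>
  have last: "apply_transforms padded (map Suc js @ [0]) ?x =
      pad_vec n (of_nat k - of_nat (length js)) 0 (S *\<^sub>v apply_transforms Ts js v)"
    if "set js \<subseteq> {..<length Ts}" for js
    using padded_running[OF that v] pad_mat_mult[OF S d h apply_transforms_carrier[OF Ts that v]]
    by simp
  have Sw: "S *\<^sub>v w \<in> carrier_vec h" for w using S by (simp add: carrier_vecI)
  have pad_nth: "pad_vec n a b w $ 0 = a" "pad_vec n a b w $ 1 = b" for a b w
    by (simp_all add: pad_vec_def)
  {
    assume ?R
    then obtain js where js: "length js = k" "set js \<subseteq> {..<length Ts}"
        "S *\<^sub>v apply_transforms Ts js v = 0\<^sub>v h" by blast
    have "apply_transforms padded (map Suc js @ [0]) ?x = 0\<^sub>v n"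
      using last[OF js(2)] js pad_vec_zero[OF h] by simp
    moreover have "length (map Suc js @ [0]) = Suc k" "set (map Suc js @ [0]) \<subseteq> {..<length padded}"
      using js by auto
    ultimately show ?L by blast
  }
  assume ?L
  then obtain "is" where is_: "length is = Suc k" "set is \<subseteq> {..<length padded}"
      "apply_transforms padded is ?x = 0\<^sub>v n" by blast
  \<comment> \<open>A word avoiding index 0 is a shifted word over \<open>Ts\<close>.\<close>
  have Suc_pred: "map Suc (map (\<lambda>i. i - 1) ys) = ys" if "0 \<notin> set ys" for ys
    using that by (induction ys) auto
  have sub: "set (map (\<lambda>i. i - 1) ys) \<subseteq> {..<length Ts}" if "0 \<notin> set ys" "set ys \<subseteq> {..<length padded}" for ys
  proof -
    have "i - 1 < length Ts" if "i \<in> set ys" for i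
      using that \<open>0 \<notin> set ys\<close> \<open>set ys \<subseteq> {..<length padded}\<close> by (cases i) auto
    then show ?thesis by auto
  qed
  have n0: "0\<^sub>v n $ 0 = (0 :: rat)" "0\<^sub>v n $ 1 = (0 :: rat)" using d by auto
  show ?R
  proof (cases "0 \<in> set is")
    case False
    \<comment> \<open>Without the selector the second coordinate never leaves 1.\<close>
    then have "apply_transforms padded is ?x $ 1 = 1"
      using padded_running[OF sub[OF False is_(2)] v] Suc_pred[OF False] pad_nth by simp
    then show ?thesis using is_(3) n0 by simp
  next
    case True
    \<comment> \<open>Splitting at the first use of the selector.\<close>
    then obtain ys zs where yz: "is = ys @ 0 # zs" "0 \<notin> set ys" by (meson split_list_first)
    define js where "js = map (\<lambda>i. i - 1) ys"
    have ys: "ys = map Suc js" using Suc_pred[OF yz(2)] by (simp add: js_def)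
    have js: "set js \<subseteq> {..<length Ts}" unfolding js_def using yz is_ by (intro sub) auto
    define y where "y = pad_vec n (of_nat k - of_nat (length js)) 0 (S *\<^sub>v apply_transforms Ts js v)"
    have y: "apply_transforms padded (map Suc js @ [0]) ?x = y" using last[OF js] by (simp add: y_def)
    have "y \<in> carrier_vec n"
      using h S by (auto simp: y_def pad_vec_def intro!: carrier_vecI)
    moreover have z: "apply_transforms padded zs y = 0\<^sub>v n" using is_(3) yz ys y by simp
    \<comment> \<open>The first coordinate is frozen from \<open>y\<close> on, so it has to be 0
      already there; this fixes \<open>length js\<close> and leaves no room for
      \<open>zs\<close>.\<close>
    ultimately have "y $ 0 = 0"
      using padded_stopped[of zs y] is_(2) yz n0 pad_nth by (simp add: y_def)
    then have k: "length js = k" by (simp add: y_def pad_nth)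
    then have "zs = []" using is_(1) yz ys by simp
    then have "y = 0\<^sub>v n" using z by simp
    have "S *\<^sub>v apply_transforms Ts js v = 0\<^sub>v h"
    proof (rule eq_vecI)
      fix i assume "i < dim_vec (0\<^sub>v h :: rat vec)"
      then have i: "i < h" by simp
      \<comment> \<open>Behind the two front coordinates \<open>y\<close> holds the product with
        \<open>S\<close>.\<close>
      have "y $ (Suc (Suc i)) = (S *\<^sub>v apply_transforms Ts js v) $ i"
        using i S by (simp add: y_def pad_vec_def vec_of_list_index nth_append list_of_vec_index)
      then show "(S *\<^sub>v apply_transforms Ts js v) $ i = 0\<^sub>v h $ i"
        using \<open>y = 0\<^sub>v n\<close> i h by simp
    qed (use S in simp)
    then show ?thesis using k js by blast
  qed
qed

end

section \<open>The reduction on valid instances\<close>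

lemma enc_vest_text:
  "enc_vest x = bits (seq_length x) @ Bar # row_text (list_of_vec (start x)) @
     matrix_text (map list_of_vec (rows (selector x))) @
     concat (map matrix_text (map (map list_of_vec \<circ> rows) (transforms x)))"
  by (simp add: enc_vest_def enc_vec_row_text enc_mat_matrix_text o_def)

context
  fixes x :: vest and n d h :: nat
  assumes x: "valid_vest x"
  defines "n \<equiv> length (enc_vest x)" and "d \<equiv> dim_vec (start x)" and "h \<equiv> dim_row (selector x)"
begin

text \<open>Each entry of the vector and each row of the selector costs at least one symbol; the 2
  comes from the \<open>Bar\<close> after the length and the \<open>Semicolon\<close> after the
  start vector.\<close>

lemma enc_vest_bounds: "d + 2 \<le> n" "h + 2 \<le> n"
proof -
  have "d \<le> length (entries (list_of_vec (start x)))"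
    using length_entries_ge[of "list_of_vec (start x)"] by (simp add: d_def)
  moreover have "h \<le> length (matrix_text (map list_of_vec (rows (selector x))))"
    using length_matrix_text(1)[of "map list_of_vec (rows (selector x))"] by (simp add: h_def)
  moreover have "length (matrix_text rs) \<ge> 1" for rs by (simp add: matrix_text_def)
  ultimately show "d + 2 \<le> n" "h + 2 \<le> n"
    unfolding n_def enc_vest_text by (auto simp: row_text_def matrix_text_def)
qed

lemma valid_carrier:
  "d > 0" "h > 0" "selector x \<in> carrier_mat h d" "start x \<in> carrier_vec d"
  "T \<in> set (transforms x) \<Longrightarrow> T \<in> carrier_mat d d"
  using x unfolding valid_vest_def Let_def d_def h_def by (blast intro: carrier_vecI)+

lemma dim_pad_start: "dim_vec (pad_vec n a b (start x)) = n"
  using enc_vest_bounds(1) by (simp add: pad_vec_def d_def)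

lemma reduce_vest_valid: "reduce_vest x \<in> instances VEST_identity"
proof -
  note b = enc_vest_bounds
  have "valid_vest (reduce_vest x)"
    using pad_mat_carrier[OF valid_carrier(3) b] pad_mat_carrier[OF valid_carrier(5) b(1) b(1)] b
    by (auto simp: valid_vest_def Let_def reduce_vest_def n_def[symmetric] dim_pad_start)
  then show ?thesis
    by (simp add: VEST_identity_def VEST_def reduce_vest_def Let_def n_def[symmetric] dim_pad_start)
qed

lemma reduce_vest_yes: "vest_count (reduce_vest x) > 0 \<longleftrightarrow> vest_count x > 0"
proof -
  note b = enc_vest_bounds
  let ?P = "pad_mat n 0 (selector x) # map (pad_mat n 1) (transforms x)"
  let ?s = "pad_vec n (of_nat (Suc (seq_length x))) 1 (start x)"
  have c: "apply_transforms ?P is ?s \<in> carrier_vec n" if "set is \<subseteq> {..<length ?P}" for "is"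
    by (rule apply_transforms_carrier[OF padded_carrier[OF valid_carrier(3,5) b] that])
      (auto intro!: carrier_vecI simp: dim_pad_start)
  have "vest_count (reduce_vest x) > 0 \<longleftrightarrow>
      (\<exists>is. length is = Suc (seq_length x) \<and> set is \<subseteq> {..<length ?P} \<and> apply_transforms ?P is ?s = 0\<^sub>v n)"
    unfolding vest_count_pos
  proof (rule ex_cong1)
    fix "is"
    show "(length is = seq_length (reduce_vest x) \<and> set is \<subseteq> {..<length (transforms (reduce_vest x))} \<and>
          selector (reduce_vest x) *\<^sub>v
            apply_transforms (transforms (reduce_vest x)) is (start (reduce_vest x)) =
          0\<^sub>v (dim_row (selector (reduce_vest x)))) =
        (length is = Suc (seq_length x) \<and> set is \<subseteq> {..<length ?P} \<and> apply_transforms ?P is ?s = 0\<^sub>v n)"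
      using one_mult_mat_vec[OF c, of "is"]
      by (simp add: reduce_vest_def Let_def n_def[symmetric] del: of_nat_Suc cong: conj_cong)
  qed
  also have "\<dots> \<longleftrightarrow> vest_count x > 0"
    unfolding vest_count_pos h_def[symmetric]
    by (rule padded_zero_iff[OF valid_carrier(3,5) b valid_carrier(4)])
  finally show ?thesis .
qed

text \<open>Brings the encoding into the form of the output tape in \<open>runs_reduce\<close>, with
  all matrices read as lists of rows.\<close>

lemma enc_reduce_vest:
  "enc_vest (reduce_vest x) =
     bits (Suc (seq_length x)) @ Bar #
     row_text ([of_nat (Suc (seq_length x)), 1] @ list_of_vec (start x) @ replicate (n - 2 - d) 0) @
     matrix_text (identity_rows n) @
     matrix_text (pad_rows n 0 (map list_of_vec (rows (selector x)))) @
     concat (map (\<lambda>rs. matrix_text (pad_rows n 1 rs)) (map (map list_of_vec \<circ> rows) (transforms x)))"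
proof -
  note b = enc_vest_bounds
  have "enc_mat (1\<^sub>m n) = matrix_text (identity_rows n)"
    by (simp add: enc_mat_matrix_text rows_identity)
  moreover have "concat (map (\<lambda>T. enc_mat (pad_mat n 1 T)) (transforms x)) =
      concat (map (\<lambda>T. matrix_text (pad_rows n 1 (map list_of_vec (rows T)))) (transforms x))"
    using enc_pad_mat[OF valid_carrier(5) b(1) b(1)] by (intro arg_cong[where f = concat] map_cong) auto
  ultimately show ?thesis
    unfolding enc_vest_def[of "reduce_vest x"] using enc_pad_mat[OF valid_carrier(3) b]
    by (simp add: reduce_vest_def Let_def n_def[symmetric] enc_vec_row_text pad_vec_def list_vec d_def o_def
        del: vec_of_list_Cons)
qed

lemma reduce_vest_computes:
  "computes_within (machine 4 reduce) (enc_vest x) (enc_vest (reduce_vest x)) (n ^ 6)"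
proof -
  let ?S = "map list_of_vec (rows (selector x))"
  let ?Rs = "map (map list_of_vec \<circ> rows) (transforms x)"
  let ?xs = "list_of_vec (start x)"
  have S: "length r \<le> length ?xs" if "r \<in> set ?S" for r
    using that valid_carrier(3) by (auto simp: rows_def d_def)
  have Rs: "length r \<le> length ?xs" if rs: "rs \<in> set ?Rs" "r \<in> set rs" for rs r
  proof -
    obtain T where "T \<in> set (transforms x)" "rs = map list_of_vec (rows T)"
      using rs(1) by auto
    then show ?thesis using rs(2) valid_carrier(5)[of T] by (auto simp: rows_def d_def)
  qed
  have "length ?xs = d" "length ?S = h" by (simp_all add: d_def h_def)
  then have "?xs \<noteq> []" "?S \<noteq> []" using valid_carrier(1,2) by (metis less_irrefl list.size(3))+
  from runs_reduce[where S = ?S and xs = ?xs and Rs = ?Rs and k = "seq_length x", OF S Rs this,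
      folded enc_vest_text[of x], folded n_def]
  have "\<exists>s. runs reduce [zip_tape [] (enc_vest x), zip_tape [] [], zip_tape [] [], zip_tape [] []]
     (s # zip_tape (enc_vest (reduce_vest x)) [] # [zip_tape [] (zeros n), zip_tape [] (zeros n)]) (n ^ 6)"
    unfolding enc_reduce_vest by (simp only: d_def length_list_of_vec)
  then obtain s where s: "runs reduce [zip_tape [] (enc_vest x), zip_tape [] [], zip_tape [] [], zip_tape [] []]
     (s # zip_tape (enc_vest (reduce_vest x)) [] # [zip_tape [] (zeros n), zip_tape [] (zeros n)]) (n ^ 6)"
    by blast
  have "(content (enc_vest x), 0) # replicate (4 - 1) (content [], 0) =
      [zip_tape [] (enc_vest x), zip_tape [] [], zip_tape [] [], zip_tape [] []]"
    by (simp add: zip_tape_def numeral_eq_Suc)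
  from s[folded this] show ?thesis
    by (rule runs_computes_within) (simp add: zip_tape_def)
qed

text \<open>Even the identity map requires copying the input to the output tape. The exponent 3
  absorbs the constants in \<open>3 * n + 1\<close>, as \<open>n\<close> is at least 2.\<close>

lemma copy_computes:
  "computes_within (machine 2 (copy_until None)) (enc_vest x) (enc_vest x) (n ^ 3)"
proof -
  have n: "2 \<le> n" using enc_vest_bounds by simp
  have "2 * n \<le> n * n" "4 \<le> n * n" using n mult_le_mono[OF n n] by auto
  then have "4 * n \<le> n * n * n" by (intro mult_right_mono) auto
  then have t: "3 * n + 1 \<le> n ^ 3" using n unfolding power3_eq_cube by linarith
  have r: "runs (copy_until None) (zip_tape [] (enc_vest x @ []) # zip_tape [] [] # [])
     (zip_tape ([] @ enc_vest x) [] # zip_tape ([] @ enc_vest x) [] # []) (n ^ 3)"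
    by (rule runs_copy_until[THEN runs_weaken]) (use t in \<open>simp_all add: n_def\<close>)
  have "(content (enc_vest x), 0) # replicate (2 - 1) (content [], 0) =
      zip_tape [] (enc_vest x @ []) # zip_tape [] [] # []"
    by (simp add: zip_tape_def)
  from r[folded this] show ?thesis
    by (rule runs_computes_within) (simp add: zip_tape_def)
qed

end

section \<open>The two reductions\<close>

theorem theorem9:
  "(\<exists>R. param_reduction VEST VEST_identity R) \<and> (\<exists>R. param_reduction VEST_identity VEST R)"
proof
  let ?f = "\<lambda>k :: nat. 2 * k + 1"
  \<comment> \<open>A time bound may be multiplied by \<open>2 * k + 1\<close>, since the
    \<open>2 * k * t\<close> additional iterations start in a halted configuration.\<close>
  have scale: "computes_within M w u (?f k * t)" if "computes_within M w u t" for M w u k t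
  proof -
    obtain q s where q: "(step M ^^ t) (initial M w) = (q, s)" by fastforce
    then have "q = state_count M" using that by (simp add: computes_within_def)
    then have "(step M ^^ (2 * k * t + t)) (initial M w) = (q, s)"
      using q step_halted[where M = M and s = s and t = "2 * k * t"] by (simp only: funpow_add o_apply)
    then show ?thesis using that q by (simp add: computes_within_def algebra_simps)
  qed
  have "param_reduction VEST VEST_identity reduce_vest"
    unfolding param_reduction_def
  proof (intro conjI ballI exI[of _ ?f] exI[of _ "machine 4 reduce"] exI[of _ "6 :: nat"])
    fix x assume "x \<in> instances VEST"
    then have x: "valid_vest x" by (simp add: VEST_def)
    show "reduce_vest x \<in> instances VEST_identity" using x by (rule reduce_vest_valid)
    show "yes VEST x = yes VEST_identity (reduce_vest x)"
      using reduce_vest_yes[OF x] by (simp add: VEST_def VEST_identity_def)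
    show "parameter VEST_identity (reduce_vest x) \<le> ?f (parameter VEST x)"
      by (simp add: VEST_def VEST_identity_def reduce_vest_def Let_def)
    show "computes_within (machine 4 reduce) (encode VEST x) (encode VEST_identity (reduce_vest x))
        (?f (parameter VEST x) * length (encode VEST x) ^ 6)"
      using scale[OF reduce_vest_computes[OF x]] by (simp add: VEST_def VEST_identity_def)
  qed (rule computable_odd wf_machine | simp)+
  then show "\<exists>R. param_reduction VEST VEST_identity R" by blast
  have "param_reduction VEST_identity VEST (\<lambda>x. x)"
    unfolding param_reduction_def
  proof (intro conjI ballI exI[of _ ?f] exI[of _ "machine 2 (copy_until None)"] exI[of _ "3 :: nat"])
    fix x assume "x \<in> instances VEST_identity"
    then have x: "valid_vest x" by (simp add: VEST_def VEST_identity_def)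
    then show "x \<in> instances VEST" by (simp add: VEST_def)
    show "computes_within (machine 2 (copy_until None)) (encode VEST_identity x) (encode VEST x)
        (?f (parameter VEST_identity x) * length (encode VEST_identity x) ^ 3)"
      using scale[OF copy_computes[OF x]] by (simp add: VEST_def VEST_identity_def)
  qed (rule computable_odd wf_machine | simp add: VEST_def VEST_identity_def)+
  then show "\<exists>R. param_reduction VEST_identity VEST R" by blast
qed

end
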